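(* Let $(\mathcal U,\sigma)$ be an algebraically closed inversive difference field, $K\subseteq\mathcal U$ a difference subfield with $\sigma(K)=K$, and $a$ a finite tuple in $\mathcal U$ with $\sigma(a)\in K(a)^{alg}$. Let $c\in K(a)_\sigma$ be a finite tuple such that $a\in K(c)^{alg}$ and $\sigma(c)\in K(c,\sigma^\ell(c))$ for every $\ell>0$. Then $\mathrm{dd}(a/K)=\mathrm{ld}(c/K)$. In particular there is $c\in K(a)_\sigma$ with $a\in K(c)^{alg}$ and $\mathrm{dd}(c/K)=\mathrm{ld}(c/K)=\mathrm{dd}(a/K)$.
   Context: $K(a)_\sigma=K(\sigma^i(a)\mid i\in\mathbb N)$; $E^{alg}$ is the algebraic closure of a field $E$; for a tuple $a$ algebraic over a field $L$, $\mu(a/L)=[L(a):L]$. For a tuple $a$ with $\sigma(a)\in K(a)^{alg}$: $\mathrm{ld}(a/K)=\lim_{k\to\infty}\mu(\sigma^{k+1}(a)/K(a,\sigma(a),\dots,\sigma^k(a)))$ and $\mathrm{dd}(a/K)=\lim_{k\to\infty}\mu(\sigma^k(a)/K(a))^{1/k}$. *)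

theory Defs
  imports Complex_Main "HOL-Algebra.Algebra"
begin

text \<open>
  Subfields of the ambient field \<open>U\<close> are subsets of its carrier, finite tuples are lists of
  elements of the carrier, and \<open>\<sigma>\<^sup>n(a)\<close> is \<open>map (\<sigma> ^^ n) a\<close>.
\<close>

definition adjoin :: "('a, 'b) ring_scheme \<Rightarrow> 'a set \<Rightarrow> 'a list \<Rightarrow> 'a set"
  where "adjoin U K a = generate_field U (K \<union> set a)"

definition adjoin_iterates ::
    "('a, 'b) ring_scheme \<Rightarrow> ('a \<Rightarrow> 'a) \<Rightarrow> 'a set \<Rightarrow> 'a list \<Rightarrow> nat \<Rightarrow> 'a set"
  where "adjoin_iterates U \<sigma> K a k = generate_field U (K \<union> (\<Union>i\<le>k. set (map (\<sigma> ^^ i) a)))"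

definition difference_adjoin ::
    "('a, 'b) ring_scheme \<Rightarrow> ('a \<Rightarrow> 'a) \<Rightarrow> 'a set \<Rightarrow> 'a list \<Rightarrow> 'a set"
  where "difference_adjoin U \<sigma> K a = generate_field U (K \<union> (\<Union>i. set (map (\<sigma> ^^ i) a)))"

text \<open>
  The relative algebraic closure in \<open>U\<close>; as \<open>U\<close> will be algebraically closed, this is an
  algebraic closure of \<open>E\<close>.
\<close>

definition acl :: "('a, 'b) ring_scheme \<Rightarrow> 'a set \<Rightarrow> 'a set"
  where "acl U E = {x \<in> carrier U. (ring.algebraic U over E) x}"

text \<open>
  The degree of \<open>L(a)\<close> over \<open>L\<close>. The library's \<open>dim\<close> is unspecified for infinite-dimensional
  spaces, so this is meaningful only for tuples algebraic over \<open>L\<close>.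
\<close>

definition mu :: "('a, 'b) ring_scheme \<Rightarrow> 'a list \<Rightarrow> 'a set \<Rightarrow> nat"
  where "mu U a L = (ring.dim U over L) (adjoin U L a)"

definition ld_seq ::
    "('a, 'b) ring_scheme \<Rightarrow> ('a \<Rightarrow> 'a) \<Rightarrow> 'a list \<Rightarrow> 'a set \<Rightarrow> nat \<Rightarrow> real"
  where "ld_seq U \<sigma> a K k = real (mu U (map (\<sigma> ^^ (k + 1)) a) (adjoin_iterates U \<sigma> K a k))"

definition ld :: "('a, 'b) ring_scheme \<Rightarrow> ('a \<Rightarrow> 'a) \<Rightarrow> 'a list \<Rightarrow> 'a set \<Rightarrow> real"
  where "ld U \<sigma> a K = lim (ld_seq U \<sigma> a K)"

definition dd_seq ::
    "('a, 'b) ring_scheme \<Rightarrow> ('a \<Rightarrow> 'a) \<Rightarrow> 'a list \<Rightarrow> 'a set \<Rightarrow> nat \<Rightarrow> real"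
  where "dd_seq U \<sigma> a K k = real (mu U (map (\<sigma> ^^ k) a) (adjoin U K a)) powr (1 / real k)"

definition dd :: "('a, 'b) ring_scheme \<Rightarrow> ('a \<Rightarrow> 'a) \<Rightarrow> 'a list \<Rightarrow> 'a set \<Rightarrow> real"
  where "dd U \<sigma> a K = lim (dd_seq U \<sigma> a K)"

end

theory Submission
  imports Defs
begin

text \<open>
  Write \<open>a\<^sub>i = \<sigma>\<^sup>i(a)\<close> and \<open>d\<^sub>k = [K(a\<^sub>0, a\<^sub>k) : K(a\<^sub>0)]\<close>. If \<open>a\<close> and \<open>c\<close> are interalgebraic over
  \<open>K\<close>, the degrees \<open>d\<^sub>k\<close> of \<open>a\<close> and \<open>c\<close> differ by bounded factors, so \<open>dd\<close> does not change. The
  integers \<open>[K(c\<^sub>0, \<dots>, c\<^sub>k\<^sub>+\<^sub>1) : K(c\<^sub>0, \<dots>, c\<^sub>k)]\<close> do not increase, so their products grow like \<open>ld(c)\<^sup>k\<close>; if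
  \<open>\<sigma>(c) \<in> K(c, \<sigma>\<^sup>l(c))\<close> for all \<open>l > 0\<close>, then \<open>K(c\<^sub>0, c\<^sub>k) = K(c\<^sub>0, \<dots>, c\<^sub>k)\<close> and these products are the
  degrees that define \<open>dd(c)\<close>.

  For the existence of \<open>c\<close>, enlarge \<open>a\<close> to \<open>(a, \<dots>, \<sigma>\<^sup>M(a))\<close> so that the above degrees are constant.
  Then \<open>K(\<dots>, a\<^sub>q)\<close> and \<open>K(a\<^sub>q, \<dots>)\<close> are linearly disjoint over \<open>K(a\<^sub>q)\<close>, whence
  \<open>d\<^sub>l d\<^sub>m = d\<^sub>l\<^sub>+\<^sub>m g(l, m)\<close> with \<open>g(l, m) = [K(a\<^sub>0, a\<^sub>l, a\<^sub>l\<^sub>+\<^sub>m) : K(a\<^sub>0, a\<^sub>l\<^sub>+\<^sub>m)]\<close>, and \<open>g(l, 1)\<close> is nondecreasing in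
  \<open>l\<close> but is at most \<open>d\<^sub>1\<close>. So \<open>g\<close> is constant for \<open>l, m \<ge> N\<close>: the minimal polynomials of \<open>a\<^sub>l\<close> over
  \<open>K(a\<^sub>0, a\<^sub>l\<^sub>+\<^sub>m)\<close> do not change when the two ends are moved further away. Their coefficients \<open>c\<close>
  (for \<open>l = m = N\<close>) satisfy \<open>\<sigma>\<^sup>i(c) \<in> K(a\<^sub>0, a\<^sub>k)\<close> whenever \<open>i \<ge> 0\<close> and \<open>k \<ge> i + 2N\<close>, so
  \<open>[K(c\<^sub>0, \<dots>, c\<^sub>k) : K(c\<^sub>0)]\<close> grows no faster than \<open>d\<^sub>k\<close>. That \<open>a\<close> is algebraic over \<open>K(c)\<close> uses that
  \<open>a\<close> is algebraic over \<open>K(\<sigma>(a))\<close>, a consequence of the exchange property.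
\<close>

section \<open>Degrees of finitely generated extensions\<close>

locale extension = field R for R (structure) +
  fixes K :: "'a set"
  assumes K_subfield: "subfield K R"
begin

section \<open>Generated fields and relative algebraic closure over \<open>K\<close>\<close>

definition Fld :: "'a set \<Rightarrow> 'a set"
  where "Fld S = generate_field R (K \<union> S)"

definition cl :: "'a set \<Rightarrow> 'a set"
  where "cl S = {x \<in> carrier R. (algebraic over (Fld S)) x}"

text \<open>This is the degree of \<open>K(S, Y)\<close> over \<open>K(S)\<close>. As
  \<open>dim\<close> is unspecified in infinite dimension, the value is meaningful only for a finite
  extension, in particular for finite \<open>Y \<subseteq> cl S\<close>.\<close>

definition deg :: "'a set \<Rightarrow> 'a set \<Rightarrow> nat"
  where "deg S Y = (dim over (Fld S)) (Fld (S \<union> Y))"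

lemma K_subset: "K \<subseteq> carrier R"
  using subfieldE(3)[OF K_subfield] .

lemma Fld_subfield: "S \<subseteq> carrier R \<Longrightarrow> subfield (Fld S) R"
  unfolding Fld_def using K_subset by (intro generate_field_is_subfield) auto

lemma Fld_carrier: "S \<subseteq> carrier R \<Longrightarrow> Fld S \<subseteq> carrier R"
  using subfieldE(3)[OF Fld_subfield] .

lemma Fld_incl: "S \<subseteq> Fld S" "K \<subseteq> Fld S"
  unfolding Fld_def by (auto intro: generate_field.incl)

lemma Fld_least: "\<lbrakk> subfield E R; K \<subseteq> E; S \<subseteq> E \<rbrakk> \<Longrightarrow> Fld S \<subseteq> E"
  unfolding Fld_def using subfieldE(3)[of E R] by (intro generate_field_min_subfield1) blast+

lemma Fld_mono: "\<lbrakk> S \<subseteq> Y; Y \<subseteq> carrier R \<rbrakk> \<Longrightarrow> Fld S \<subseteq> Fld Y"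
  unfolding Fld_def using K_subset by (intro mono_generate_field) auto

lemma Fld_le: "\<lbrakk> S \<subseteq> Fld Y; Y \<subseteq> carrier R \<rbrakk> \<Longrightarrow> Fld S \<subseteq> Fld Y"
  by (intro Fld_least Fld_subfield Fld_incl)

lemma Fld_absorb:
  assumes "Y \<subseteq> Fld S" "S \<subseteq> carrier R"
  shows "Fld (S \<union> Y) = Fld S"
proof
  have "Y \<subseteq> carrier R"
    using assms Fld_carrier by blast
  then show "Fld S \<subseteq> Fld (S \<union> Y)"
    using assms by (intro Fld_mono) auto
  show "Fld (S \<union> Y) \<subseteq> Fld S"
    using assms Fld_incl by (intro Fld_le) auto
qed

lemma generate_field_Fld:
  assumes "S \<subseteq> carrier R" "Y \<subseteq> carrier R"
  shows "generate_field R (Fld S \<union> Y) = Fld (S \<union> Y)"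
proof
  have "Fld S \<subseteq> Fld (S \<union> Y)" "Y \<subseteq> Fld (S \<union> Y)"
    using assms Fld_incl(1)[of "S \<union> Y"] Fld_mono[of S "S \<union> Y"] by auto
  then show "generate_field R (Fld S \<union> Y) \<subseteq> Fld (S \<union> Y)"
    using assms Fld_carrier[OF assms(1)]
    by (intro generate_field_min_subfield1 Fld_subfield) auto
  show "Fld (S \<union> Y) \<subseteq> generate_field R (Fld S \<union> Y)"
    unfolding Fld_def[of "S \<union> Y"] using assms Fld_carrier[OF assms(1)] Fld_incl[of S]
    by (intro mono_generate_field) auto
qed

text \<open>Adjoining algebraic elements as a ring already gives a field; this connects the
  library's results on dimensions with \<open>Fld\<close>.\<close>

lemma finite_extension_eq_Fld:
  assumes "set ys \<subseteq> cl S" "S \<subseteq> carrier R"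
  shows "finite_extension (Fld S) ys = Fld (S \<union> set ys)"
proof
  note F = Fld_subfield[OF assms(2)]
  have ys: "set ys \<subseteq> carrier R" using assms(1) unfolding cl_def by auto
  have "subfield (finite_extension (Fld S) ys) R"
    using assms ys F by (intro finite_extension_is_subfield) (auto simp: cl_def)
  then show "Fld (S \<union> set ys) \<subseteq> finite_extension (Fld S) ys"
    using finite_extension_incl[OF Fld_carrier[OF assms(2)] ys]
      finite_extension_mem[OF subfieldE(1)[OF F] ys] Fld_incl[of S]
    by (intro Fld_least) auto
  have "Fld S \<subseteq> Fld (S \<union> set ys)" using assms ys by (intro Fld_mono) auto
  then show "finite_extension (Fld S) ys \<subseteq> Fld (S \<union> set ys)"
    using ys assms Fld_incl[of "S \<union> set ys"]
    by (intro finite_extension_subring_incl subfieldE(1)[OF Fld_subfield]) auto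
qed

lemma cl_carrier: "cl S \<subseteq> carrier R"
  unfolding cl_def by auto

lemma cl_subfield: "S \<subseteq> carrier R \<Longrightarrow> subfield (cl S) R"
  unfolding cl_def by (intro subfield_of_algebraics Fld_subfield)

lemma Fld_subset_cl: "S \<subseteq> carrier R \<Longrightarrow> Fld S \<subseteq> cl S"
  unfolding cl_def
  using algebraic_self[OF subfieldE(1)[OF Fld_subfield]] Fld_carrier by blast

lemma cl_incl: "S \<subseteq> carrier R \<Longrightarrow> S \<subseteq> cl S"
  using Fld_subset_cl Fld_incl by blast

lemma cl_mono_Fld: "Fld S \<subseteq> Fld Y \<Longrightarrow> cl S \<subseteq> cl Y"
  unfolding cl_def using algebraic_mono by blast

lemma cl_mono: "\<lbrakk> S \<subseteq> Y; Y \<subseteq> carrier R \<rbrakk> \<Longrightarrow> cl S \<subseteq> cl Y"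
  by (intro cl_mono_Fld Fld_mono)

lemma Fld_subset_cl_if:
  assumes "Y \<subseteq> cl S" "S \<subseteq> carrier R"
  shows "Fld Y \<subseteq> cl S"
  using assms Fld_subset_cl[OF assms(2)] Fld_incl(2)[of S] by (intro Fld_least cl_subfield) auto

lemma finite_dimension_Fld:
  assumes "finite Y" "Y \<subseteq> cl S" "S \<subseteq> carrier R"
  shows "finite_dimension (Fld S) (Fld (S \<union> Y))"
proof -
  obtain ys where ys: "set ys = Y" using finite_list[OF assms(1)] by blast
  show ?thesis
    using finite_extension_eq_Fld[of ys S] ys assms
      finite_extension_finite_dimension(1)[OF Fld_subfield[OF assms(3)], of ys]
    by (auto simp: cl_def)
qed

text \<open>Only the finitely many coefficients of an equation of \<open>x\<close> over \<open>Fld Y\<close> matter, and these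
  generate a finite extension of \<open>Fld S\<close>.\<close>

lemma cl_trans:
  assumes "Y \<subseteq> cl S" "S \<subseteq> carrier R"
  shows "cl Y \<subseteq> cl S"
proof
  fix x assume "x \<in> cl Y"
  then have x: "x \<in> carrier R" "(algebraic over (Fld Y)) x" by (auto simp: cl_def)
  have Y: "Y \<subseteq> carrier R" using assms cl_carrier by blast
  obtain p where p: "p \<in> carrier ((Fld Y)[X])" "p \<noteq> []" "eval p x = \<zero>"
    using algebraicE[OF subfieldE(1)[OF Fld_subfield[OF Y]] x] .
  then have sp: "set p \<subseteq> cl S"
    using Fld_subset_cl_if[OF assms] polynomial_incl[of "Fld Y" p]
    unfolding univ_poly_carrier[symmetric] by blast
  let ?L = "Fld (S \<union> set p)"
  have carr: "S \<union> set p \<subseteq> carrier R" using sp assms cl_carrier by blast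
  note L = Fld_subfield[OF carr]
  have "p \<in> carrier (?L[X])"
    using p Fld_incl(1)[of "S \<union> set p"] unfolding univ_poly_carrier[symmetric] polynomial_def by auto
  then have alg: "(algebraic over ?L) x" using p algebraicI by blast
  have "finite_dimension (Fld S) (simple_extension ?L x)"
    using telescopic_base_dim(1)[OF Fld_subfield[OF assms(2)] L finite_dimension_Fld[OF _ sp assms(2)]]
      finite_dimension_simple_extension[OF L x(1)] alg by auto
  then have "(algebraic over (Fld S)) x"
    using finite_dimension_imp_algebraic[OF Fld_subfield[OF assms(2)]
        simple_extension_is_subring[OF subfieldE(1)[OF L] x(1)]]
      simple_extension_mem[OF subfieldE(1)[OF L] x(1)] by blast
  then show "x \<in> cl S" using x by (simp add: cl_def)
qed

section \<open>Degrees in towers, and minimal polynomials\<close>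

lemma deg_tower:
  assumes "S \<subseteq> carrier R" "finite Y" "Y \<subseteq> cl S" "finite Z" "Z \<subseteq> cl S"
  shows "deg S (Y \<union> Z) = deg S Y * deg (S \<union> Y) Z"
proof -
  have XY: "S \<union> Y \<subseteq> carrier R" using assms cl_carrier by blast
  have "Z \<subseteq> cl (S \<union> Y)" using cl_mono[OF _ XY, of S] assms by blast
  then show ?thesis
    unfolding deg_def Un_assoc[symmetric]
    using telescopic_base_dim(2)[OF Fld_subfield[OF assms(1)] Fld_subfield[OF XY]
      finite_dimension_Fld[OF assms(2,3,1)] finite_dimension_Fld[OF assms(4) _ XY]] by simp
qed

lemma deg_one:
  assumes "S \<subseteq> carrier R" "Y \<subseteq> Fld S"
  shows "deg S Y = 1"
  unfolding deg_def Fld_absorb[OF assms(2,1)]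
  by (intro dimI dimension_one Fld_subfield assms)

lemma deg_pos:
  assumes "S \<subseteq> carrier R" "finite Y" "Y \<subseteq> cl S"
  shows "deg S Y \<ge> 1"
proof (rule ccontr)
  assume "\<not> deg S Y \<ge> 1"
  then have "deg S Y = 0" by simp
  then have "dimension 0 (Fld S) (Fld (S \<union> Y))"
    using finite_dimensionE[OF Fld_subfield[OF assms(1)] finite_dimension_Fld[OF assms(2,3,1)]]
    unfolding deg_def by simp
  then have "Fld (S \<union> Y) = {\<zero>}"
    using dimension_zero[OF Fld_subfield[OF assms(1)]] by blast
  moreover have "\<one> \<in> Fld (S \<union> Y)"
    unfolding Fld_def by (rule generate_field.one)
  ultimately show False by simp
qed

lemma deg_singleton:
  assumes "S \<subseteq> carrier R" "y \<in> cl S"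
  shows "deg S {y} = degree (Irr (Fld S) y)"
proof -
  have y: "y \<in> carrier R" "(algebraic over (Fld S)) y" using assms by (auto simp: cl_def)
  show ?thesis
    using finite_extension_eq_Fld[of "[y]" S] assms
      simple_extension_dim[OF Fld_subfield[OF assms(1)] y]
    by (simp add: deg_def)
qed

lemma Irr_degree_le:
  assumes "S \<subseteq> carrier R" "y \<in> cl S" "p \<in> carrier ((Fld S)[X])" "p \<noteq> []" "eval p y = \<zero>"
  shows "degree (Irr (Fld S) y) \<le> degree p"
proof -
  note F = Fld_subfield[OF assms(1)]
  have y: "y \<in> carrier R" "(algebraic over (Fld S)) y" using assms by (auto simp: cl_def)
  show ?thesis
    using pdivides_imp_degree_le[OF subfieldE(1)[OF F] IrrE(1)[OF F y] assms(3,4)]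
      Irr_minimal[OF F y assms(3,5)] by blast
qed

lemma Irr_not_Nil:
  assumes "S \<subseteq> carrier R" "y \<in> cl S"
  shows "Irr (Fld S) y \<noteq> []"
proof -
  have y: "y \<in> carrier R" "(algebraic over (Fld S)) y" using assms by (auto simp: cl_def)
  have "polynomial (Fld S) (Irr (Fld S) y)" "degree (Irr (Fld S) y) \<ge> 1"
    using IrrE(1)[OF Fld_subfield[OF assms(1)] y] deg_pos[OF assms(1), of "{y}"] assms
    by (auto simp: univ_poly_carrier deg_singleton)
  then show ?thesis by force
qed

text \<open>The minimal polynomial over the smaller field still annihilates \<open>y\<close> over
  the larger one.\<close>

lemma deg_singleton_antimono:
  assumes "S \<subseteq> S'" "S' \<subseteq> carrier R" "y \<in> cl S"
  shows "deg S' {y} \<le> deg S {y}"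
proof -
  have S: "S \<subseteq> carrier R" and y: "y \<in> cl S'"
    using assms cl_mono[OF assms(1,2)] by auto
  have y': "y \<in> carrier R" "(algebraic over (Fld S)) y" using assms by (auto simp: cl_def)
  note I = IrrE[OF Fld_subfield[OF S] y']
  have "Irr (Fld S) y \<in> carrier ((Fld S')[X])"
    using I(1) Fld_mono[OF assms(1,2)] unfolding univ_poly_carrier[symmetric] polynomial_def by auto
  then show ?thesis
    using Irr_degree_le[OF assms(2) y _ Irr_not_Nil[OF S assms(3)] I(4)] S y assms
    by (simp add: deg_singleton)
qed

text \<open>Adjoining one generator at a time writes both degrees as products that can be compared
  factor by factor.\<close>

lemma deg_antimono:
  assumes "S \<subseteq> S'" "S' \<subseteq> carrier R" "finite Y" "Y \<subseteq> cl S"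
  shows "deg S' Y \<le> deg S Y"
  using assms(3,4)
proof (induction Y)
  case empty
  then show ?case using assms deg_one[of S "{}"] deg_one[of S' "{}"] by simp
next
  case (insert y Y)
  have S: "S \<subseteq> carrier R" using assms by auto
  have sub: "cl S \<subseteq> cl S'" "S \<union> Y \<subseteq> S' \<union> Y" "S' \<union> Y \<subseteq> carrier R"
    using assms insert.prems cl_mono[OF assms(1,2)] cl_carrier by blast+
  have "{y} \<subseteq> cl S'" "Y \<subseteq> cl S'" using insert.prems sub by auto
  then have tower: "deg S' (insert y Y) = deg S' Y * deg (S' \<union> Y) {y}"
    using deg_tower[OF assms(2), of Y "{y}"] insert.hyps by simp
  have "y \<in> cl (S \<union> Y)"
    using insert.prems cl_mono[of S "S \<union> Y"] sub S by auto
  then have "deg S' Y * deg (S' \<union> Y) {y} \<le> deg S Y * deg (S \<union> Y) {y}"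
    using insert by (intro mult_le_mono deg_singleton_antimono sub) auto
  then show ?case
    using deg_tower[OF S, of Y "{y}"] tower insert.hyps insert.prems by simp
qed

lemma deg_mono:
  assumes "S \<subseteq> carrier R" "Y \<subseteq> Y'" "finite Y'" "Y' \<subseteq> cl S"
  shows "deg S Y \<le> deg S Y'"
proof -
  have "deg S Y' = deg S Y * deg (S \<union> Y) Y'"
    using deg_tower[OF assms(1), of Y Y'] assms finite_subset[OF assms(2,3)]
    by (simp add: Un_absorb1)
  moreover have "deg (S \<union> Y) Y' \<ge> 1"
    using assms cl_carrier cl_mono[of S "S \<union> Y"] by (intro deg_pos) blast+
  ultimately show ?thesis by simp
qed

text \<open>Adjoin \<open>y\<close> first and then the rest of \<open>Y\<close>. Neither of the two
  degrees can grow when the base does, so if their product is unchanged, both are.\<close>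

lemma deg_eq_imp_deg_singleton_eq:
  assumes "S \<subseteq> S'" "S' \<subseteq> carrier R" "finite Y" "Y \<subseteq> cl S" "deg S' Y = deg S Y" "y \<in> Y"
  shows "deg S' {y} = deg S {y}"
proof -
  have S: "S \<subseteq> carrier R" and y: "y \<in> cl S" and Y: "Y \<subseteq> cl S'"
    using assms cl_mono[OF assms(1,2)] by auto
  have yY: "{y} \<union> Y = Y" using assms by auto
  have Xy: "S' \<union> {y} \<subseteq> carrier R" using assms Y cl_carrier by blast
  have "deg S {y} * deg (S \<union> {y}) Y = deg S Y" "deg S' {y} * deg (S' \<union> {y}) Y = deg S' Y"
    using deg_tower[OF S, of "{y}" Y] deg_tower[OF assms(2), of "{y}" Y] assms y Y yY by auto
  moreover have "deg S' {y} \<le> deg S {y}"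
    using assms y by (intro deg_singleton_antimono)
  moreover have "Y \<subseteq> cl (S \<union> {y})"
    using cl_mono[of S "S \<union> {y}"] Xy assms by blast
  then have "deg (S' \<union> {y}) Y \<le> deg (S \<union> {y}) Y"
    using assms Xy by (intro deg_antimono) auto
  moreover have "deg S Y \<ge> 1" using S assms by (intro deg_pos)
  ultimately have "\<not> deg S' {y} < deg S {y}"
    using assms(5) mult_less_le_imp_less[of "deg S' {y}" "deg S {y}" "deg (S' \<union> {y}) Y" "deg (S \<union> {y}) Y"]
    by (metis One_nat_def Suc_le_lessD less_irrefl mult_0_right neq0_conv zero_le)
  with \<open>deg S' {y} \<le> deg S {y}\<close> show ?thesis by simp
qed

text \<open>The difference of two monic annihilators of the same minimal degree has lower degree and
  still vanishes at \<open>y\<close>, so it is zero.\<close>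

lemma Irr_unique:
  assumes "S \<subseteq> carrier R" "y \<in> cl S" "p \<in> carrier ((Fld S)[X])" "p \<noteq> []" "lead_coeff p = \<one>"
    and "eval p y = \<zero>" "degree p = degree (Irr (Fld S) y)"
  shows "p = Irr (Fld S) y"
proof -
  let ?F = "Fld S" let ?I = "Irr ?F y"
  note F = Fld_subfield[OF assms(1)]
  note sF = subfieldE(1)[OF F]
  have y: "y \<in> carrier R" "(algebraic over ?F) y" using assms by (auto simp: cl_def)
  note I = IrrE[OF F y]
  interpret UP: domain "?F[X]" using univ_poly_is_domain[OF sF] .
  have setp: "set p \<subseteq> ?F" "set ?I \<subseteq> ?F"
    using assms(3) I(1) polynomial_incl unfolding univ_poly_carrier[symmetric] by blast+
  define q where "q = p \<ominus>\<^bsub>?F[X]\<^esub> ?I"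
  have len: "length p = length ?I"
    using assms(4,7) Irr_not_Nil[OF assms(1,2)] by (cases p; cases ?I) auto
  have mI: "\<ominus>\<^bsub>?F[X]\<^esub> ?I = map (\<lambda>a. \<ominus> a) ?I"
    using univ_poly_a_inv_def'[OF sF I(1)] .
  have q: "q \<in> carrier (?F[X])" unfolding q_def using assms(3) I(1) by simp
  have ev: "eval q y = \<zero>"
    using ring_hom_memE[OF eval_is_hom[OF sF y(1)]] assms(3,6) I(1,4)
      ring_hom_cring.hom_sub[OF eval_cring_hom[OF sF y(1)]]
    unfolding q_def by simp
  have q_eq: "q = poly_add p (map (\<lambda>a. \<ominus> a) ?I)"
    unfolding q_def a_minus_def mI univ_poly_add ..
  have carr: "set p \<subseteq> carrier R" "set (map (\<lambda>a. \<ominus> a) ?I) \<subseteq> carrier R" "set ?I \<subseteq> carrier R"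
    using setp Fld_carrier[OF assms(1)] by auto
  have q_len: "length q \<le> length p"
    unfolding q_eq using poly_add_length_le[of p "map (\<lambda>a. \<ominus> a) ?I"] len by simp
  have q_lead: "coeff q (degree p) = \<zero>"
  proof -
    have "coeff (map (\<lambda>a. \<ominus> a) ?I) (degree p) = \<ominus> \<one>"
      using lead_coeff_simp[of "map (\<lambda>a. \<ominus> a) ?I"] assms(7) Irr_not_Nil[OF assms(1,2)] I(3)
      by (simp add: hd_map)
    then show ?thesis
      unfolding q_eq poly_add_coeff[OF carr(1,2)]
      using lead_coeff_simp[OF assms(4)] assms(5) by (simp add: r_neg)
  qed
  have "q = []"
  proof (rule ccontr)
    assume qn: "q \<noteq> []"
    have "degree p \<le> degree q"
      using Irr_degree_le[OF assms(1,2) q qn ev] assms(7) by simp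
    then have "degree q = degree p" using q_len by simp
    then have "lead_coeff q = \<zero>" using q_lead lead_coeff_simp[OF qn] by simp
    then show False using q qn unfolding univ_poly_carrier[symmetric] polynomial_def by blast
  qed
  then have "p \<ominus>\<^bsub>?F[X]\<^esub> ?I = \<zero>\<^bsub>?F[X]\<^esub>" by (simp add: q_def univ_poly_zero)
  then show ?thesis using assms(3) I(1) by (simp add: UP.r_right_minus_eq)
qed

text \<open>When the degree does not drop, the old minimal polynomial is monic of the right degree
  over the larger field. This is how equalities of degrees become equalities of
  coefficients.\<close>

lemma Irr_eq_if_deg_eq:
  assumes "S \<subseteq> S'" "S' \<subseteq> carrier R" "y \<in> cl S" "deg S' {y} = deg S {y}"
  shows "Irr (Fld S') y = Irr (Fld S) y"
proof -
  have S: "S \<subseteq> carrier R" and y: "y \<in> cl S'"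
    using assms cl_mono[OF assms(1,2)] by auto
  have y': "y \<in> carrier R" "(algebraic over (Fld S)) y" using assms by (auto simp: cl_def)
  note I = IrrE[OF Fld_subfield[OF S] y']
  have "Irr (Fld S) y \<in> carrier ((Fld S')[X])"
    using I(1) Fld_mono[OF assms(1,2)] unfolding univ_poly_carrier[symmetric] polynomial_def by auto
  then show ?thesis
    using Irr_unique[OF assms(2) y _ Irr_not_Nil[OF S assms(3)] I(3,4)] assms S y
    by (simp add: deg_singleton)
qed

end

section \<open>The exchange property\<close>

lemma (in ring) eval_scalar_mult:
  assumes "set p \<subseteq> carrier R" "a \<in> carrier R" "x \<in> carrier R"
  shows "eval (map (\<lambda>b. a \<otimes> b) p) x = a \<otimes> eval p x"
  using assms(1)
proof (induction p)
  case (Cons b p)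
  then show ?case using assms(2,3) eval_in_carrier[of p x] by (simp add: r_distr m_assoc)
qed (simp add: assms)

text \<open>Fractions of elements of \<open>T\<close> are closed under the field operations. The
  fraction is stated as \<open>z \<otimes> v = u\<close> to avoid inverses.\<close>

lemma (in field) generate_field_fraction:
  assumes "subring T R" "z \<in> generate_field R T"
  shows "\<exists>u\<in>T. \<exists>v\<in>T - {\<zero>}. z \<otimes> v = u"
proof -
  note T = subringE[OF assms(1)]
  note in_carr = subsetD[OF T(1)]
  note gen = generate_field_in_carrier[OF T(1)]
  from assms(2) show ?thesis
  proof induction
    case one
    have "\<one> \<otimes> \<one> = \<one>" by simp
    then show ?case using T(3) one_not_zero by blast
  next
    case (incl h)
    then have "h \<otimes> \<one> = h" using in_carr by simp
    then show ?case using incl T(3) one_not_zero by blast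
  next
    case (a_inv h)
    then obtain u v where uv: "u \<in> T" "v \<in> T - {\<zero>}" "h \<otimes> v = u" by blast
    then have "\<ominus> h \<otimes> v = \<ominus> u" using in_carr gen[OF a_inv.hyps] by (simp add: l_minus)
    then show ?case using uv T(5) by blast
  next
    case (m_inv h)
    then obtain u v where uv: "u \<in> T" "v \<in> T - {\<zero>}" "h \<otimes> v = u" by blast
    have h: "h \<in> carrier R" "inv h \<in> carrier R" "inv h \<otimes> h = \<one>"
      using gen[OF m_inv.hyps(1)] m_inv.hyps(2) field_Units by auto
    have v: "v \<in> carrier R" using uv in_carr by auto
    have "u \<noteq> \<zero>" using uv h v m_inv.hyps(2) integral_iff by blast
    moreover have "inv h \<otimes> u = v" using uv h v m_assoc[of "inv h" h v] by auto
    ultimately show ?case using uv by blast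
  next
    case (eng_add h1 h2)
    then obtain u1 v1 u2 v2 where uv: "u1 \<in> T" "v1 \<in> T - {\<zero>}" "h1 \<otimes> v1 = u1"
      "u2 \<in> T" "v2 \<in> T - {\<zero>}" "h2 \<otimes> v2 = u2" by blast
    have c: "h1 \<in> carrier R" "h2 \<in> carrier R" "v1 \<in> carrier R" "v2 \<in> carrier R"
      using gen[OF eng_add.hyps(1)] gen[OF eng_add.hyps(2)] uv in_carr by auto
    have "(h1 \<oplus> h2) \<otimes> (v1 \<otimes> v2) = (h1 \<otimes> v1) \<otimes> v2 \<oplus> (h2 \<otimes> v2) \<otimes> v1"
      using c l_distr[of h1 h2 "v1 \<otimes> v2"] by (simp add: m_ac)
    moreover have "v1 \<otimes> v2 \<in> T - {\<zero>}" "u1 \<otimes> v2 \<oplus> u2 \<otimes> v1 \<in> T"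
      using uv c integral_iff T(6,7) by auto
    ultimately show ?case using uv by blast
  next
    case (eng_mult h1 h2)
    then obtain u1 v1 u2 v2 where uv: "u1 \<in> T" "v1 \<in> T - {\<zero>}" "h1 \<otimes> v1 = u1"
      "u2 \<in> T" "v2 \<in> T - {\<zero>}" "h2 \<otimes> v2 = u2" by blast
    have c: "h1 \<in> carrier R" "h2 \<in> carrier R" "v1 \<in> carrier R" "v2 \<in> carrier R"
      using gen[OF eng_mult.hyps(1)] gen[OF eng_mult.hyps(2)] uv in_carr by auto
    have "(h1 \<otimes> h2) \<otimes> (v1 \<otimes> v2) = (h1 \<otimes> v1) \<otimes> (h2 \<otimes> v2)"
      using c by (simp add: m_ac)
    moreover have "v1 \<otimes> v2 \<in> T - {\<zero>}" "u1 \<otimes> u2 \<in> T"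
      using uv c integral_iff T(6) by auto
    ultimately show ?case using uv by blast
  qed
qed

lemma (in field) common_denominator:
  assumes "subring T R" "set p \<subseteq> generate_field R T"
  shows "\<exists>d\<in>T - {\<zero>}. \<forall>z\<in>set p. d \<otimes> z \<in> T"
  using assms(2)
proof (induction p)
  case Nil
  then show ?case using subringE(3)[OF assms(1)] by (intro bexI[of _ \<one>]) auto
next
  case (Cons a p)
  note in_carr = subsetD[OF subringE(1)[OF assms(1)]]
  note gen = generate_field_in_carrier[OF subringE(1)[OF assms(1)]]
  obtain d where d: "d \<in> T" "d \<noteq> \<zero>" "\<And>z. z \<in> set p \<Longrightarrow> d \<otimes> z \<in> T" using Cons by auto
  obtain v where v: "v \<in> T" "v \<noteq> \<zero>" "a \<otimes> v \<in> T"
    using generate_field_fraction[OF assms(1), of a] Cons.prems by auto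
  have c: "d \<in> carrier R" "v \<in> carrier R" "a \<in> carrier R"
    using d v Cons.prems in_carr gen by auto
  have "d \<otimes> v \<otimes> z \<in> T" if "z \<in> set (a # p)" for z
  proof (cases "z = a")
    case True
    have "d \<otimes> v \<otimes> a = d \<otimes> (a \<otimes> v)" using c by (simp add: l_distr m_ac)
    then show ?thesis using True d v subringE(6)[OF assms(1)] by simp
  next
    case False
    then have z: "z \<in> set p" "z \<in> carrier R" using that Cons.prems gen by auto
    have "d \<otimes> v \<otimes> z = v \<otimes> (d \<otimes> z)" using c z by (simp add: m_ac)
    then show ?thesis using d(3)[OF z(1)] v subringE(6)[OF assms(1)] by simp
  qed
  then show ?case using d v c integral_iff subringE(6)[OF assms(1)]
    by (intro bexI[of _ "d \<otimes> v"]) auto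
qed

text \<open>A polynomial in \<open>y\<close> whose coefficients are polynomials \<open>f q\<close> in \<open>x\<close>, rewritten as a
  polynomial in \<open>x\<close>.\<close>

lemma (in domain) exchange_variables:
  assumes "subfield L R" "x \<in> carrier R" "y \<in> L"
    and "\<And>q. q \<in> set qs \<Longrightarrow> set (f q) \<subseteq> L \<and> eval (f q) x = q"
  shows "\<exists>P. set P \<subseteq> L \<and> eval P x = eval qs y \<and>
    (\<forall>i. coeff P i = eval (map (\<lambda>q. coeff (f q) i) qs) y)"
  using assms(4)
proof (induction qs)
  case Nil
  show ?case by (rule exI[of _ "[]"]) simp
next
  case (Cons q qs)
  note L = subfieldE(1)[OF assms(1)]
  note in_carr = subsetD[OF subringE(1)[OF L]]
  obtain P where P: "set P \<subseteq> L" "eval P x = eval qs y"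
    "\<And>i. coeff P i = eval (map (\<lambda>q. coeff (f q) i) qs) y" using Cons by auto
  have fq: "set (f q) \<subseteq> L" "eval (f q) x = q" using Cons.prems by auto
  let ?n = "length qs" let ?g = "map (\<lambda>b. y [^] ?n \<otimes> b) (f q)"
  have yn: "y [^] ?n \<in> L" using subringE(3,6)[OF L] assms(3) by (induction qs) auto
  have g: "set ?g \<subseteq> L" using yn fq subringE(6)[OF L] by auto
  have carr: "set P \<subseteq> carrier R" "set ?g \<subseteq> carrier R" "set (f q) \<subseteq> carrier R" "y \<in> carrier R"
    using P g fq assms(3) in_carr by blast+
  have "q \<in> carrier R" using eval_in_carrier[OF carr(3) assms(2)] fq by simp
  have "set (poly_add ?g P) \<subseteq> L"
    using poly_add_is_polynomial[OF L g P(1)] polynomial_incl by blast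
  moreover have "eval (poly_add ?g P) x = eval (q # qs) y"
    unfolding eval_poly_add[OF carr(2,1) assms(2)]
    using eval_scalar_mult[OF carr(3) _ assms(2), of "y [^] ?n"] carr fq P \<open>q \<in> carrier R\<close>
    by (simp add: m_comm)
  moreover have "coeff (poly_add ?g P) i = eval (map (\<lambda>q. coeff (f q) i) (q # qs)) y" for i
    unfolding poly_add_coeff[OF carr(2,1)]
    using scalar_coeff[of "y [^] ?n" "f q"] carr P by (simp add: m_comm)
  ultimately show ?case by blast
qed

text \<open>Here \<open>p\<close> may have leading zeros, so it is normalized before transcendence
  is applied.\<close>

lemma (in domain) transcendental_coeffs_zero:
  assumes "subring F R" "x \<in> carrier R" "(transcendental over F) x" "set p \<subseteq> F" "eval p x = \<zero>"
  shows "coeff p i = \<zero>"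
proof -
  have "set p \<subseteq> carrier R" using assms subringE(1) by blast
  then have "eval (normalize p) x = \<zero>" using eval_normalize assms by simp
  moreover have "normalize p \<in> carrier (F[X])"
    using normalize_gives_polynomial[OF assms(4)] by (simp add: univ_poly_carrier)
  ultimately have "normalize p = []" using eval_transcendental[OF assms(3)] by blast
  then show ?thesis using normalize_coeff[of p] by simp
qed

context extension begin

text \<open>An equation of \<open>y\<close> over \<open>K(S, x)\<close>, cleared of denominators, is
  a polynomial relation between \<open>x\<close> and \<open>y\<close> over \<open>K(S)\<close>. If
  \<open>x\<close> were transcendental over \<open>K(S, y)\<close>, each coefficient of a power of
  \<open>x\<close> would vanish; these are polynomials in \<open>y\<close>, which is transcendental
  over \<open>K(S)\<close>, so the whole relation would be trivial.\<close>

lemma exchange: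
  assumes "S \<subseteq> carrier R" "x \<in> carrier R" "y \<in> cl (insert x S)" "y \<notin> cl S"
  shows "x \<in> cl (insert y S)"
proof (rule ccontr)
  assume "x \<notin> cl (insert y S)"
  let ?F = "Fld S" let ?L = "Fld (insert y S)" let ?T = "simple_extension ?F x"
  have y: "y \<in> carrier R" "(algebraic over (Fld (insert x S))) y" "(transcendental over ?F) y"
    using assms by (auto simp: cl_def over_def)
  have x: "(transcendental over ?L) x" using \<open>x \<notin> _\<close> assms by (auto simp: cl_def over_def)
  have Sx: "insert x S \<subseteq> carrier R" and Sy: "insert y S \<subseteq> carrier R" using assms y by auto
  note F = Fld_subfield[OF assms(1)] and L = Fld_subfield[OF Sy]
  note sF = subfieldE(1)[OF F] and sL = subfieldE(1)[OF L]
  have T: "subring ?T R" using simple_extension_is_subring[OF sF assms(2)] .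
  have FT: "?F \<subseteq> ?T" "x \<in> ?T"
    using simple_extension_incl[OF Fld_carrier[OF assms(1)] assms(2)]
      simple_extension_mem[OF sF assms(2)] by auto
  have FL: "?F \<subseteq> ?L" using Sy by (intro Fld_mono) auto
  have "Fld (insert x S) \<subseteq> generate_field R ?T"
    using FT Fld_incl[of S] subringE(1)[OF T] unfolding Fld_def[of "insert x S"]
    by (intro mono_generate_field) auto
  moreover obtain p where p: "p \<in> carrier ((Fld (insert x S))[X])" "p \<noteq> []" "eval p y = \<zero>"
    using algebraicE[OF subfieldE(1)[OF Fld_subfield[OF Sx]] y(1,2)] .
  then have p': "set p \<subseteq> Fld (insert x S)" "lead_coeff p \<noteq> \<zero>"
    unfolding univ_poly_carrier[symmetric] polynomial_def by auto
  ultimately obtain d where d: "d \<in> ?T - {\<zero>}" "\<And>z. z \<in> set p \<Longrightarrow> d \<otimes> z \<in> ?T"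
    using common_denominator[OF T, of p] by blast
  have d_carr: "d \<in> carrier R" and p_carr: "set p \<subseteq> carrier R"
    using d subringE(1)[OF T] p' Fld_carrier[OF Sx] by auto
  \<comment> \<open>After scaling by \<open>d\<close>, every coefficient \<open>q\<close> of the
    equation is the value at \<open>x\<close> of a polynomial \<open>f q\<close> over
    \<open>?F\<close>.\<close>
  define qs where "qs = map (\<lambda>b. d \<otimes> b) p"
  define f where "f q = (SOME r. r \<in> carrier (?F[X]) \<and> eval r x = q)" for q
  have f: "f q \<in> carrier (?F[X])" "eval (f q) x = q" if "q \<in> set qs" for q
  proof -
    have "q \<in> (\<lambda>r. eval r x) ` carrier (?F[X])"
      using that d simple_extension_as_eval_img[OF Fld_carrier[OF assms(1)] assms(2)]
      by (auto simp: qs_def)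
    then have "\<exists>r. r \<in> carrier (?F[X]) \<and> eval r x = q" by blast
    then have "f q \<in> carrier (?F[X]) \<and> eval (f q) x = q" unfolding f_def by (rule someI_ex)
    then show "f q \<in> carrier (?F[X])" "eval (f q) x = q" by auto
  qed
  have f_set: "set (f q) \<subseteq> ?F" if "q \<in> set qs" for q
    using f(1)[OF that] polynomial_incl unfolding univ_poly_carrier[symmetric] by blast
  obtain P where P: "set P \<subseteq> ?L" "eval P x = eval qs y"
    "\<And>i. coeff P i = eval (map (\<lambda>q. coeff (f q) i) qs) y"
    using exchange_variables[OF L assms(2), of y qs f] f f_set FL Fld_incl(1)[of "insert y S"]
    by blast
  have "eval P x = \<zero>"
    unfolding P(2) qs_def eval_scalar_mult[OF p_carr d_carr y(1)] p(3) using d_carr by simp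
  then have P0: "coeff P i = \<zero>" for i
    using transcendental_coeffs_zero[OF sL assms(2) x P(1)] by blast
  have coeff_F: "coeff (f q) i \<in> ?F" if "q \<in> set qs" for q i
  proof -
    have "coeff (f q) i \<in> set (f q) \<union> {\<zero>}" unfolding coeff_img(3)[symmetric] by (rule rangeI)
    then show ?thesis using f_set[OF that] subringE(2)[OF sF] by auto
  qed
  have zero: "coeff (f q) i = \<zero>" if "q \<in> set qs" for q i
  proof -
    \<comment> \<open>For fixed \<open>i\<close>, the coefficients at the \<open>i\<close>-th power
      of \<open>x\<close> form a polynomial in \<open>y\<close> over \<open>?F\<close> with value
      \<open>coeff P i\<close>, which is zero.\<close>
    let ?r = "map (\<lambda>q. coeff (f q) i) qs"
    have "coeff ?r j = \<zero>" for j
      using transcendental_coeffs_zero[OF sF y(1,3), of ?r] P(3)[of i] P0 coeff_F by auto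
    then have "set ?r \<subseteq> {\<zero>}" using coeff_img_restrict[of ?r] by auto
    then show ?thesis using that by auto
  qed
  have "hd p \<in> carrier R" using p(2) p_carr by auto
  then have hd: "hd qs \<in> set qs" "hd qs \<noteq> \<zero>"
    using p(2) p'(2) p_carr d d_carr integral_iff[of d "hd p"] by (auto simp: qs_def hd_map)
  have "f (hd qs) = []"
  proof (rule ccontr)
    assume "f (hd qs) \<noteq> []"
    moreover from this have "lead_coeff (f (hd qs)) = \<zero>"
      using zero[OF hd(1)] lead_coeff_simp by metis
    ultimately show False
      using f(1)[OF hd(1)] unfolding univ_poly_carrier[symmetric] polynomial_def by simp
  qed
  then show False using f(2)[OF hd(1)] hd(2) by simp
qed

section \<open>Independent sets and Steinitz exchange\<close>

lemma cl_insert_absorb: "\<lbrakk> b \<in> cl S; S \<subseteq> carrier R \<rbrakk> \<Longrightarrow> cl (insert b S) \<subseteq> cl S"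
  using cl_incl by (intro cl_trans) auto

text \<open>Steinitz exchange: some \<open>b\<close> in \<open>B\<close> but not in \<open>I\<close>
  is replaced by some \<open>x\<close> in \<open>I\<close> but not in \<open>B\<close>, without
  shrinking the closure. This lowers \<open>card (I - B)\<close>, and when
  \<open>I \<subseteq> B\<close> the equal cardinalities give \<open>I = B\<close>.\<close>

lemma independent_generates:
  assumes "finite B" "B \<subseteq> carrier R" "finite I" "card I = card B" "I \<subseteq> cl B"
    and "\<And>x. x \<in> I \<Longrightarrow> x \<notin> cl (I - {x})"
  shows "B \<subseteq> cl I"
  using assms
proof (induction "card (I - B)" arbitrary: B rule: less_induct)
  case less
  have I: "I \<subseteq> carrier R" using less.prems cl_carrier by blast
  show ?case
  proof (cases "I \<subseteq> B")
    case True
    then have "I = B" using less.prems by (intro card_subset_eq) auto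
    then show ?thesis using cl_incl[OF I] by simp
  next
    case False
    then obtain x where x: "x \<in> I" "x \<notin> B" by blast
    \<comment> \<open>For a maximal \<open>C\<close> in this family, any \<open>b\<close> in
      \<open>B - C\<close> puts \<open>x\<close> into the closure of \<open>insert b C\<close>, so
      \<open>b\<close> can be exchanged for \<open>x\<close>. Since \<open>C\<close> contains
      \<open>B \<inter> I\<close>, no element of \<open>I\<close> is given up.\<close>
    define \<C> where "\<C> = {C. B \<inter> I \<subseteq> C \<and> C \<subseteq> B \<and> x \<notin> cl C}"
    have "x \<notin> cl (B \<inter> I)"
      using less.prems(6)[OF x(1)] cl_mono[of "B \<inter> I" "I - {x}"] I x by blast
    then have "B \<inter> I \<in> \<C>" unfolding \<C>_def by auto
    moreover have "finite \<C>" using less.prems(1) by (auto simp: \<C>_def intro: finite_subset[of _ "Pow B"])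
    ultimately obtain C where C: "C \<in> \<C>" "\<And>D. D \<in> \<C> \<Longrightarrow> C \<subseteq> D \<Longrightarrow> C = D"
      using finite_has_maximal[of \<C>] by blast
    have CB: "C \<subseteq> B" "B \<inter> I \<subseteq> C" "x \<notin> cl C" using C(1) by (auto simp: \<C>_def)
    then have "C \<noteq> B" using less.prems(5) x by blast
    then obtain b where b: "b \<in> B" "b \<notin> C" using CB by blast
    have C_carr: "C \<subseteq> carrier R" "b \<in> carrier R" "x \<in> carrier R" using CB b x I less.prems by auto
    have "x \<in> cl (insert b C)"
    proof (rule ccontr)
      assume "x \<notin> cl (insert b C)"
      then have "insert b C \<in> \<C>" using CB b by (auto simp: \<C>_def)
      then show False using C(2)[of "insert b C"] b by blast
    qed
    then have b_cl: "b \<in> cl (insert x C)"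
      using exchange[OF C_carr(1,2)] CB(3) by blast
    let ?B = "insert x (B - {b})"
    have B'_carr: "?B \<subseteq> carrier R" using less.prems C_carr by auto
    have b_cl': "b \<in> cl ?B" using b_cl cl_mono[OF _ B'_carr, of "insert x C"] CB b by blast
    then have B_cl: "B \<subseteq> cl ?B" using cl_incl[OF B'_carr] by blast
    have "I - ?B \<subset> I - B" using x b CB by auto
    then have "card (I - ?B) < card (I - B)" using less.prems by (intro psubset_card_mono) auto
    moreover have "card I = card ?B" using less.prems x b card_Suc_Diff1[of B b] by simp
    moreover have "I \<subseteq> cl ?B" using cl_trans[OF B_cl B'_carr] less.prems by blast
    ultimately have "?B \<subseteq> cl I" using less.prems B'_carr by (intro less.hyps) auto
    then show ?thesis using cl_trans[OF _ I] B_cl by blast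
  qed
qed

end

section \<open>The action of the automorphism on fields, closures and degrees\<close>

locale difference_extension = extension +
  fixes \<sigma> :: "'a \<Rightarrow> 'a"
  assumes \<sigma>_iso: "\<sigma> \<in> ring_iso R R" and \<sigma>_K: "\<sigma> ` K = K"
begin

lemma \<sigma>_hom: "ring_hom_ring R R \<sigma>"
  using \<sigma>_iso unfolding ring_iso_def by (intro ring_hom_ringI2 ring_axioms) auto

lemma \<sigma>_bij: "bij_betw \<sigma> (carrier R) (carrier R)"
  using ring_iso_memE(5)[OF \<sigma>_iso] .

lemma \<sigma>_image_carrier: "S \<subseteq> carrier R \<Longrightarrow> \<sigma> ` S \<subseteq> carrier R"
  using \<sigma>_bij by (auto simp: bij_betw_def)

lemma image_Fld_superset:
  assumes "S \<subseteq> carrier R"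
  shows "Fld (\<sigma> ` S) \<subseteq> \<sigma> ` Fld S"
proof (rule Fld_least)
  show "subfield (\<sigma> ` Fld S) R"
    using ring_hom_ring.img_is_subfield(2)[OF \<sigma>_hom Fld_subfield[OF assms]] by simp
  show "K \<subseteq> \<sigma> ` Fld S" "\<sigma> ` S \<subseteq> \<sigma> ` Fld S" using \<sigma>_K Fld_incl[of S] by blast+
qed

text \<open>One-sided inclusions for \<open>\<sigma>\<close>, applied to its inverse as well, become
  equalities.\<close>

lemma difference_extension_inverse: "difference_extension R K (inv_into (carrier R) \<sigma>)"
proof unfold_locales
  show "inv_into (carrier R) \<sigma> \<in> ring_iso R R"
    using ring_iso_set_sym[OF ring_axioms \<sigma>_iso] .
  show "inv_into (carrier R) \<sigma> ` K = K"
    using \<sigma>_K K_subset \<sigma>_bij inv_into_image_cancel[of \<sigma> "carrier R" K] by (auto simp: bij_betw_def)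
qed

lemma inverse_image:
  assumes "S \<subseteq> carrier R"
  shows "inv_into (carrier R) \<sigma> ` \<sigma> ` S = S" "\<sigma> ` inv_into (carrier R) \<sigma> ` S = S"
  using assms \<sigma>_bij by (auto simp: bij_betw_def inv_into_image_cancel image_inv_into_cancel)

lemma image_Fld:
  assumes "S \<subseteq> carrier R"
  shows "\<sigma> ` Fld S = Fld (\<sigma> ` S)"
proof
  interpret inv: difference_extension R K "inv_into (carrier R) \<sigma>"
    by (rule difference_extension_inverse)
  have S': "\<sigma> ` S \<subseteq> carrier R" using \<sigma>_image_carrier[OF assms] .
  have "Fld S \<subseteq> inv_into (carrier R) \<sigma> ` Fld (\<sigma> ` S)"
    using inv.image_Fld_superset[OF S'] inverse_image[OF assms] by simp
  then show "\<sigma> ` Fld S \<subseteq> Fld (\<sigma> ` S)"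
    using inverse_image(2)[OF Fld_carrier[OF S']] by blast
  show "Fld (\<sigma> ` S) \<subseteq> \<sigma> ` Fld S" using image_Fld_superset[OF assms] .
qed

lemma image_cl_subset:
  assumes "S \<subseteq> carrier R"
  shows "\<sigma> ` cl S \<subseteq> cl (\<sigma> ` S)"
proof
  fix y assume "y \<in> \<sigma> ` cl S"
  then obtain x where x: "y = \<sigma> x" "x \<in> carrier R" "(algebraic over (Fld S)) x" by (auto simp: cl_def)
  have "(algebraic over (\<sigma> ` Fld S)) (\<sigma> x)"
    using algebraic_hom[of \<sigma> R R "Fld S" x] \<sigma>_iso x Fld_subfield[OF assms] field_axioms
    by (auto simp: ring_iso_def)
  then show "y \<in> cl (\<sigma> ` S)"
    unfolding cl_def using x \<sigma>_image_carrier[of "{x}"] image_Fld[OF assms] by auto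
qed

lemma image_cl:
  assumes "S \<subseteq> carrier R"
  shows "\<sigma> ` cl S = cl (\<sigma> ` S)"
proof
  interpret inv: difference_extension R K "inv_into (carrier R) \<sigma>"
    by (rule difference_extension_inverse)
  have "inv_into (carrier R) \<sigma> ` cl (\<sigma> ` S) \<subseteq> cl S"
    using inv.image_cl_subset[OF \<sigma>_image_carrier[OF assms]] inverse_image(1)[OF assms] by simp
  then have "\<sigma> ` inv_into (carrier R) \<sigma> ` cl (\<sigma> ` S) \<subseteq> \<sigma> ` cl S" by blast
  then show "cl (\<sigma> ` S) \<subseteq> \<sigma> ` cl S" using inverse_image(2)[OF cl_carrier] by simp
  show "\<sigma> ` cl S \<subseteq> cl (\<sigma> ` S)" by (rule image_cl_subset[OF assms])
qed

lemma deg_image: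
  assumes "S \<subseteq> carrier R" "finite Y" "Y \<subseteq> cl S"
  shows "deg (\<sigma> ` S) (\<sigma> ` Y) = deg S Y"
proof -
  have SY: "S \<union> Y \<subseteq> carrier R" using assms cl_carrier by blast
  have S': "\<sigma> ` S \<subseteq> carrier R" using \<sigma>_image_carrier[OF assms(1)] .
  have inj: "inj_on \<sigma> (Fld (S \<union> Y))"
    using \<sigma>_bij Fld_carrier[OF SY] by (auto simp: bij_betw_def intro: inj_on_subset)
  have "dimension (deg S Y) (\<sigma> ` Fld S) (\<sigma> ` Fld (S \<union> Y))"
    using ring_hom_ring.inj_hom_dimension[OF \<sigma>_hom Fld_subfield[OF assms(1)] _ inj]
      finite_dimensionE[OF Fld_subfield[OF assms(1)] finite_dimension_Fld[OF assms(2,3,1)]]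
    unfolding deg_def by simp
  then show ?thesis
    unfolding image_Fld[OF assms(1)] image_Fld[OF SY] image_Un
    using dimI[OF Fld_subfield[OF S']] unfolding deg_def by blast
qed

text \<open>A minimal \<open>B \<subseteq> A\<close> with \<open>A \<subseteq> cl B\<close> is
  independent. Its image under \<open>\<sigma>\<close> is independent, has the same size and lies in
  \<open>cl B\<close>, so by exchange its closure contains \<open>B\<close>, hence
  \<open>A\<close>.\<close>

lemma subset_cl_image:
  assumes "finite A" "A \<subseteq> carrier R" "\<sigma> ` A \<subseteq> cl A"
  shows "A \<subseteq> cl (\<sigma> ` A)"
proof -
  define \<B> where "\<B> = {B. B \<subseteq> A \<and> A \<subseteq> cl B}"
  have "A \<in> \<B>" using cl_incl[OF assms(2)] by (auto simp: \<B>_def)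
  moreover have "finite \<B>" using assms(1) by (auto simp: \<B>_def intro: finite_subset[of _ "Pow A"])
  ultimately obtain B where B: "B \<in> \<B>" "\<And>C. C \<in> \<B> \<Longrightarrow> C \<subseteq> B \<Longrightarrow> C = B"
    using finite_has_minimal[of \<B>] by blast
  have BA: "B \<subseteq> A" "A \<subseteq> cl B" using B(1) by (auto simp: \<B>_def)
  have B_fin: "finite B" and B_carr: "B \<subseteq> carrier R" and inj: "inj_on \<sigma> B"
    using BA assms \<sigma>_bij by (auto intro: finite_subset inj_on_subset simp: bij_betw_def)
  have indep: "x \<notin> cl (B - {x})" if "x \<in> B" for x
  proof
    assume x: "x \<in> cl (B - {x})"
    have "cl B \<subseteq> cl (B - {x})"
      using cl_insert_absorb[OF x] that B_carr by (auto simp: insert_absorb)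
    then have "B - {x} \<in> \<B>" using BA by (auto simp: \<B>_def)
    then show False using B(2)[of "B - {x}"] that by blast
  qed
  have "B \<subseteq> cl (\<sigma> ` B)"
  proof (rule independent_generates)
    show "\<sigma> ` B \<subseteq> cl B" using assms BA cl_trans[OF BA(2) B_carr] by blast
    show "card (\<sigma> ` B) = card B" using card_image[OF inj] .
    fix y assume "y \<in> \<sigma> ` B"
    then obtain x where x: "x \<in> B" "y = \<sigma> x" by blast
    have "\<sigma> ` B - {y} = \<sigma> ` (B - {x})" using inj x by (auto simp: inj_on_def)
    moreover have "\<sigma> x \<notin> \<sigma> ` cl (B - {x})"
    proof
      assume "\<sigma> x \<in> \<sigma> ` cl (B - {x})"
      then obtain z where z: "z \<in> cl (B - {x})" "\<sigma> x = \<sigma> z" by blast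
      then have "x = z"
        using \<sigma>_bij subsetD[OF cl_carrier z(1)] subsetD[OF B_carr x(1)]
        by (auto simp: bij_betw_def dest: inj_onD)
      then show False using indep[OF x(1)] z by simp
    qed
    ultimately show "y \<notin> cl (\<sigma> ` B - {y})"
      using image_cl[of "B - {x}"] B_carr x by auto
  qed (use B_fin B_carr in auto)
  then have "A \<subseteq> cl (\<sigma> ` B)" using BA cl_trans[OF _ \<sigma>_image_carrier[OF B_carr]] by blast
  also have "\<dots> \<subseteq> cl (\<sigma> ` A)" using BA assms \<sigma>_image_carrier by (intro cl_mono) auto
  finally show ?thesis .
qed

end

section \<open>Degrees between iterates\<close>

text \<open>\<open>deg I J\<close> stands for the degree of the iterates with exponents in
  \<open>J\<close> over the field generated by those with exponents in \<open>I\<close>. The base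
  \<open>I\<close> is nonempty because the iterates may be transcendental over \<open>K\<close>
  itself.\<close>

locale index_degree =
  fixes deg :: "nat set \<Rightarrow> nat set \<Rightarrow> nat"
  assumes tower: "\<lbrakk> finite I; I \<noteq> {}; finite J; finite L \<rbrakk> \<Longrightarrow> deg I (J \<union> L) = deg I J * deg (I \<union> J) L"
    and antimono: "\<lbrakk> I \<subseteq> I'; finite I'; I \<noteq> {}; finite J \<rbrakk> \<Longrightarrow> deg I' J \<le> deg I J"
    and shift: "\<lbrakk> finite I; I \<noteq> {}; finite J \<rbrakk> \<Longrightarrow> deg (Suc ` I) (Suc ` J) = deg I J"
    and pos: "\<lbrakk> finite I; I \<noteq> {}; finite J \<rbrakk> \<Longrightarrow> deg I J > 0"
    and stable: "deg {0..k} {Suc k} = deg {0} {1}"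
begin

text \<open>Taking the same set twice in the tower law gives \<open>d = d * d\<close> for a positive
  \<open>d\<close>.\<close>

lemma one_if_subset:
  assumes "finite I" "I \<noteq> {}" "J \<subseteq> I"
  shows "deg I J = 1"
proof -
  have J: "finite J" using assms finite_subset by blast
  have "deg I J = deg I J * deg I J"
    using tower[OF assms(1,2) J J] assms(3) by (simp add: Un_absorb2)
  then show ?thesis using pos[OF assms(1,2) J] by simp
qed

lemma shift_add:
  assumes "finite I" "I \<noteq> {}" "finite J"
  shows "deg ((\<lambda>j. j + i) ` I) ((\<lambda>j. j + i) ` J) = deg I J"
proof (induction i)
  case (Suc i)
  have "(\<lambda>j. j + Suc i) ` A = Suc ` (\<lambda>j. j + i) ` A" for A :: "nat set" by (simp add: image_image)
  then show ?case using Suc shift[of "(\<lambda>j. j + i) ` I" "(\<lambda>j. j + i) ` J"] assms by simp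
qed simp

lemma deg_interval: "deg {0..q} {q..q + m} = deg {0} {1} ^ m"
proof (induction m)
  case 0
  then show ?case using one_if_subset[of "{0..q}" "{q}"] by auto
next
  case (Suc m)
  have "{q..q + Suc m} = {q..q + m} \<union> {Suc (q + m)}" "{0..q} \<union> {q..q + m} = {0..q + m}" by auto
  then show ?case
    using tower[of "{0..q}" "{q..q + m}" "{Suc (q + m)}"] stable[of "q + m"] Suc by simp
qed

text \<open>By stability the past \<open>{..q}\<close> and the future \<open>{q..}\<close> are linearly disjoint over the
  present \<open>{q}\<close>.\<close>

lemma disjoint:
  assumes "q \<in> I" "I \<subseteq> {..q}" "J \<subseteq> {q..}" "finite J"
  shows "deg I J = deg {q} J"
proof (rule antisym)
  have I: "finite I" using assms finite_subset by blast
  show "deg I J \<le> deg {q} J" using assms I by (intro antimono) auto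
  obtain m where m: "J \<subseteq> {q..q + m}"
  proof (cases "J = {}")
    case False
    have "J \<subseteq> {q..q + (Max J - q)}"
    proof
      fix j assume "j \<in> J"
      then have "q \<le> j" "j \<le> Max J" using assms by auto
      then show "j \<in> {q..q + (Max J - q)}" by simp
    qed
    then show ?thesis using that by blast
  qed (use that in auto)
  let ?L = "{q..q + m}"
  have JL: "J \<union> ?L = ?L" using m by auto
  \<comment> \<open>The interval \<open>?L\<close> has the same degree over \<open>{0..q}\<close> as
    over \<open>{q}\<close>. Splitting it at \<open>J\<close>, the second factor over
    \<open>{0..q}\<close> is at most the one over \<open>{q}\<close>, so the first is at least the
    one over \<open>{q}\<close>.\<close>
  have eq: "deg {0..q} J * deg ({0..q} \<union> J) ?L = deg {q} J * deg ({q} \<union> J) ?L"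
  proof -
    have "deg {0..q} J * deg ({0..q} \<union> J) ?L = deg {0..q} ?L"
      using tower[of "{0..q}" J ?L] assms JL by simp
    also have "\<dots> = deg {0} {0..m}"
      using deg_interval[of q m] deg_interval[of 0 m] by simp
    also have "\<dots> = deg {q} ?L"
      using shift_add[of "{0}" "{0..m}" q] by (simp add: add.commute)
    also have "\<dots> = deg {q} J * deg ({q} \<union> J) ?L"
      using tower[of "{q}" J ?L] assms JL by simp
    finally show ?thesis .
  qed
  have "deg ({0..q} \<union> J) ?L \<le> deg ({q} \<union> J) ?L"
    using assms by (intro antimono) auto
  then have "deg {0..q} J * deg ({0..q} \<union> J) ?L \<le> deg {0..q} J * deg ({q} \<union> J) ?L" by simp
  then have "deg {q} J \<le> deg {0..q} J"
    unfolding eq using pos[of "{q} \<union> J" ?L] assms by simp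
  also have "\<dots> \<le> deg I J" using assms by (intro antimono) auto
  finally show "deg {q} J \<le> deg I J" .
qed

text \<open>Apply \<open>disjoint\<close> to \<open>J \<union> L\<close> and to \<open>J\<close>,
  and cancel the factor of \<open>J\<close> in the two towers.\<close>

lemma disjoint_Un:
  assumes "q \<in> I" "I \<subseteq> {..q}" "J \<subseteq> {q..}" "finite J" "L \<subseteq> {q..}" "finite L"
  shows "deg (I \<union> J) L = deg ({q} \<union> J) L"
proof -
  have I: "finite I" using assms finite_subset by blast
  have "deg I J * deg (I \<union> J) L = deg {q} J * deg ({q} \<union> J) L"
    using tower[of I J L] tower[of "{q}" J L] disjoint[of q I "J \<union> L"] assms I
    by (metis Un_least empty_iff finite.emptyI finite.insertI finite_Un insert_not_empty)
  then show ?thesis using disjoint[OF assms(1-4)] pos[of "{q}" J] assms by simp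
qed

section \<open>The degree of an intermediate iterate over two ends\<close>

definition end_deg :: "nat \<Rightarrow> nat"
  where "end_deg k = deg {0} {k}"

text \<open>The degree left for the iterate \<open>l\<close> once both ends \<open>0\<close> and
  \<open>l + m\<close> are known: \<open>g(l, m)\<close> in the overview, as
  \<open>end_deg k\<close> is \<open>d\<^sub>k\<close>.\<close>

definition gap :: "nat \<Rightarrow> nat \<Rightarrow> nat"
  where "gap l m = deg {0, l + m} {l}"

lemma end_deg_pos: "end_deg k > 0"
  unfolding end_deg_def by (intro pos) auto

lemma end_deg_shift: "deg {l} {l + m} = end_deg m"
  using shift_add[of "{0}" "{m}" l] by (simp add: end_deg_def add.commute)

text \<open>Both sides are the degree of \<open>{l, l + m}\<close> over \<open>{0}\<close>, with the
  two iterates adjoined in either order. Disjointness at \<open>l\<close> turns the degree of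
  \<open>l + m\<close> over \<open>{0, l}\<close> into \<open>end_deg m\<close>.\<close>

lemma gap_mult_end_deg: "gap l m * end_deg (l + m) = end_deg l * end_deg m"
proof -
  have "end_deg l * end_deg m = deg {0} {l} * deg {0, l} {l + m}"
    using disjoint[of l "{0, l}" "{l + m}"] by (simp add: end_deg_shift end_deg_def)
  also have "\<dots> = deg {0} ({l + m} \<union> {l})"
    using tower[of "{0}" "{l}" "{l + m}"] by (simp add: insert_commute)
  also have "\<dots> = end_deg (l + m) * gap l m"
    using tower[of "{0}" "{l + m}" "{l}"] by (simp add: end_deg_def gap_def insert_commute)
  finally show ?thesis by (simp add: mult.commute)
qed

lemma gap_shift: "deg {i, i + l + m} {i + l} = gap l m"
  using shift_add[of "{0, l + m}" "{l}" i] by (simp add: gap_def algebra_simps)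

text \<open>Shift by one. Adding the earlier iterate \<open>0\<close> to the base then changes
  nothing, by disjointness at \<open>1\<close>, and removing \<open>1\<close> from the base can only
  raise the degree.\<close>

lemma gap_mono: "gap l 1 \<le> gap (Suc l) 1"
proof -
  have "gap l 1 = deg {1, l + 2} {l + 1}" using gap_shift[of 1 l 1] by simp
  also have "\<dots> = deg ({0, 1} \<union> {l + 2}) {l + 1}"
    using disjoint_Un[of 1 "{0, 1}" "{l + 2}" "{l + 1}"] by (simp add: insert_commute)
  also have "\<dots> \<le> deg {0, l + 2} {l + 1}" by (intro antimono) auto
  also have "\<dots> = gap (Suc l) 1" by (simp add: gap_def)
  finally show ?thesis .
qed

text \<open>Otherwise \<open>end_deg\<close> would be strictly decreasing from some point on.\<close>

lemma gap_le: "gap l 1 \<le> end_deg 1"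
proof (rule ccontr)
  assume "\<not> ?thesis"
  then have less: "end_deg 1 < gap (l + j) 1" for j
    using gap_mono lift_Suc_mono_le[of "\<lambda>l. gap l 1" l "l + j"] by force
  have dec: "end_deg (l + Suc j) < end_deg (l + j)" for j
  proof (rule ccontr)
    assume "\<not> ?thesis"
    then have "end_deg (l + j) * end_deg 1 < end_deg (l + Suc j) * gap (l + j) 1"
      using less[of j] end_deg_pos[of "l + j"] by (intro mult_le_less_imp_less) auto
    then show False using gap_mult_end_deg[of "l + j" 1] by (simp add: mult.commute)
  qed
  have "end_deg (l + j) + j \<le> end_deg l" for j
  proof (induction j)
    case (Suc j)
    then show ?case using dec[of j] by linarith
  qed simp
  from this[of "Suc (end_deg l)"] show False by simp
qed

text \<open>The bounded nondecreasing \<open>gap l 1\<close> reaches its maximum \<open>H\<close>.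
  From then on \<open>end_deg\<close> is geometric with ratio \<open>end_deg 1 / H\<close>, so
  \<open>gap l m\<close>, which is \<open>end_deg l * end_deg m / end_deg (l + m)\<close>, no longer
  depends on \<open>l\<close> or on \<open>m\<close>.\<close>

lemma gap_eventually_const: "\<exists>N. \<forall>l\<ge>N. \<forall>m\<ge>N. gap l m = gap N N"
proof -
  have "\<exists>N. \<forall>l. gap l 1 \<le> gap N 1"
  proof -
    have "finite (range (\<lambda>l. gap l 1))"
      using gap_le by (intro finite_subset[OF _ finite_atMost[of "end_deg 1"]]) auto
    then have "Max (range (\<lambda>l. gap l 1)) \<in> range (\<lambda>l. gap l 1)" by (intro Max_in) auto
    then obtain N where "gap N 1 = Max (range (\<lambda>l. gap l 1))" by auto
    then show ?thesis using \<open>finite (range (\<lambda>l. gap l 1))\<close> by (intro exI[of _ N]) simp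
  qed
  then obtain N where N: "gap l 1 \<le> gap N 1" for l by blast
  define H where "H = gap N 1"
  have H: "gap l 1 = H" if "l \<ge> N" for l
    using N[of l] that lift_Suc_mono_le[of "\<lambda>l. gap l 1", OF gap_mono that] by (simp add: H_def)
  have step: "end_deg (Suc l) * H = end_deg l * end_deg 1" if "l \<ge> N" for l
    using gap_mult_end_deg[of l 1] H[OF that] by (simp add: mult.commute)
  have Suc_l: "gap (Suc l) m = gap l m" if "l \<ge> N" for l m
  proof -
    have "gap (Suc l) m * end_deg (l + m) * end_deg 1 = gap (Suc l) m * end_deg (Suc l + m) * H"
      using step[of "l + m"] that by (simp add: mult.assoc)
    also have "\<dots> = end_deg (Suc l) * H * end_deg m" unfolding gap_mult_end_deg by simp
    also have "\<dots> = gap l m * end_deg (l + m) * end_deg 1"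
      unfolding step[OF that] gap_mult_end_deg by simp
    finally show ?thesis using end_deg_pos[of "l + m"] end_deg_pos[of 1] by simp
  qed
  have l: "gap l m = gap N m" if "l \<ge> N" for l m
    using that by (induct l rule: dec_induct) (simp_all add: Suc_l)
  have Suc_m: "gap l (Suc m) = gap l m" if "m \<ge> N" for l m
  proof -
    have "gap l (Suc m) * end_deg (l + m) * end_deg 1 = gap l (Suc m) * end_deg (l + Suc m) * H"
      using step[of "l + m"] that by (simp add: mult.assoc)
    also have "\<dots> = end_deg l * (end_deg (Suc m) * H)" unfolding gap_mult_end_deg by simp
    also have "\<dots> = gap l m * end_deg (l + m) * end_deg 1"
      unfolding step[OF that] gap_mult_end_deg by simp
    finally show ?thesis using end_deg_pos[of "l + m"] end_deg_pos[of 1] by simp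
  qed
  have m: "gap l m = gap l N" if "m \<ge> N" for l m
    using that by (induct m rule: dec_induct) (simp_all add: Suc_m)
  show ?thesis using l m by metis
qed

text \<open>All three degrees equal \<open>gap N N\<close>. The base
  \<open>{0, i, i + 2 * N, k}\<close> contains both other bases, so minimal polynomials over those
  two can be compared over it.\<close>

lemma deg_between_const:
  obtains N where
    "\<And>i k. i + 2 * N \<le> k \<Longrightarrow> deg {0, i, i + 2 * N, k} {i + N} = deg {i, i + 2 * N} {i + N}"
    "\<And>i k. i + 2 * N \<le> k \<Longrightarrow> deg {0, i, i + 2 * N, k} {i + N} = deg {0, k} {i + N}"
proof -
  obtain N where N: "\<And>l m. \<lbrakk> l \<ge> N; m \<ge> N \<rbrakk> \<Longrightarrow> gap l m = gap N N"
    using gap_eventually_const by blast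
  have eqs: "deg {0, i, i + 2 * N, k} {i + N} = gap N N" "deg {i, i + 2 * N} {i + N} = gap N N"
    "deg {0, k} {i + N} = gap N N" if "i + 2 * N \<le> k" for i k
  proof -
    show 2: "deg {i, i + 2 * N} {i + N} = gap N N" using gap_shift[of i N N] by (simp add: mult_2 add.assoc)
    show "deg {0, k} {i + N} = gap N N"
      using N[of "i + N" "k - (i + N)"] that by (simp add: gap_def)
    have "deg ({0, i} \<union> {i + 2 * N}) {i + N} = gap N N"
      using disjoint_Un[of i "{0, i}" "{i + 2 * N}" "{i + N}"] 2 by (simp add: insert_commute)
    then have 3: "deg {0, i, i + 2 * N} {i + N} = gap N N" by (simp add: insert_commute)
    let ?q = "i + 2 * N"
    \<comment> \<open>Adjoin \<open>i + N\<close> and \<open>k\<close> in both orders. By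
      disjointness at \<open>?q\<close>, the iterate \<open>k\<close> contributes the same factor
      before and after \<open>i + N\<close>, and this factor cancels.\<close>
    have "gap N N * deg {?q} {k} = deg {0, i, ?q} {i + N} * deg {0, i, ?q, i + N} {k}"
      using disjoint[of ?q "{0, i, ?q, i + N}" "{k}"] that 3 by simp
    also have "\<dots> = deg {0, i, ?q} ({k} \<union> {i + N})"
      using tower[of "{0, i, ?q}" "{i + N}" "{k}"] by (simp add: insert_commute)
    also have "\<dots> = deg {0, i, ?q} {k} * deg {0, i, ?q, k} {i + N}"
      using tower[of "{0, i, ?q}" "{k}" "{i + N}"] by (simp add: insert_commute)
    also have "deg {0, i, ?q} {k} = deg {?q} {k}"
      using disjoint[of ?q "{0, i, ?q}" "{k}"] that by simp
    finally show "deg {0, i, ?q, k} {i + N} = gap N N" using pos[of "{?q}" "{k}"] by simp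
  qed
  show ?thesis by (rule that[of N]) (simp_all add: eqs)
qed

end

section \<open>Powers of the automorphism and blocks of iterates\<close>

context difference_extension begin

lemma difference_extension_funpow: "difference_extension R K (\<sigma> ^^ i)"
proof (induction i)
  case 0
  show ?case by unfold_locales (auto simp: ring_iso_def ring_hom_def bij_betw_def)
next
  case (Suc i)
  then interpret pow: difference_extension R K "\<sigma> ^^ i" .
  have "\<sigma> \<circ> (\<sigma> ^^ i) \<in> ring_iso R R"
    using ring_iso_set_trans[OF pow.\<sigma>_iso \<sigma>_iso] .
  then show ?case
    using \<sigma>_K pow.\<sigma>_K by unfold_locales (simp_all only: funpow.simps image_comp[symmetric])
qed

lemmas funpow_image_carrier = difference_extension.\<sigma>_image_carrier[OF difference_extension_funpow]
  and funpow_image_Fld = difference_extension.image_Fld[OF difference_extension_funpow]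
  and funpow_image_cl = difference_extension.image_cl[OF difference_extension_funpow]
  and funpow_deg_image = difference_extension.deg_image[OF difference_extension_funpow]

text \<open>The image polynomial is monic, vanishes at \<open>\<sigma> x\<close> and has the minimal
  degree because \<open>\<sigma>\<close> preserves \<open>deg\<close>.\<close>

lemma Irr_image:
  assumes "S \<subseteq> carrier R" "x \<in> cl S"
  shows "map \<sigma> (Irr (Fld S) x) = Irr (Fld (\<sigma> ` S)) (\<sigma> x)"
proof (rule Irr_unique)
  let ?I = "Irr (Fld S) x"
  have x: "x \<in> carrier R" "(algebraic over (Fld S)) x" using assms by (auto simp: cl_def)
  note F = Fld_subfield[OF assms(1)]
  note I = IrrE[OF F x] Irr_not_Nil[OF assms]
  have S': "\<sigma> ` S \<subseteq> carrier R" using \<sigma>_image_carrier[OF assms(1)] .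
  have x': "\<sigma> x \<in> cl (\<sigma> ` S)" using image_cl[OF assms(1)] assms(2) by blast
  have set_I: "set ?I \<subseteq> Fld S"
    using I(1) polynomial_incl unfolding univ_poly_carrier[symmetric] by blast
  show "\<sigma> ` S \<subseteq> carrier R" "\<sigma> x \<in> cl (\<sigma> ` S)" by fact+
  show "map \<sigma> ?I \<noteq> []" using I(5) by simp
  show lead: "lead_coeff (map \<sigma> ?I) = \<one>"
    using I(3,5) ring_iso_memE(4)[OF \<sigma>_iso] by (simp add: hd_map)
  show "map \<sigma> ?I \<in> carrier ((Fld (\<sigma> ` S))[X])"
    using lead set_I image_Fld[OF assms(1)]
    unfolding univ_poly_carrier[symmetric] polynomial_def by auto
  show "eval (map \<sigma> ?I) (\<sigma> x) = \<zero>"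
    using ring_hom_ring.eval_hom[OF \<sigma>_hom subfieldE(1)[OF F] x(1) I(1)] I(4)
      ring_hom_zero[OF _ ring_axioms ring_axioms, of \<sigma>] \<sigma>_iso by (simp add: ring_iso_def)
  show "degree (map \<sigma> ?I) = degree (Irr (Fld (\<sigma> ` S)) (\<sigma> x))"
    using deg_image[OF assms(1), of "{x}"] deg_singleton[OF assms] deg_singleton[OF S' x'] assms
    by simp
qed

lemmas funpow_Irr_image = difference_extension.Irr_image[OF difference_extension_funpow]

definition block :: "'a set \<Rightarrow> nat set \<Rightarrow> 'a set"
  where "block A I = (\<Union>i\<in>I. (\<sigma> ^^ i) ` A)"

lemma block_Un: "block A (I \<union> J) = block A I \<union> block A J"
  by (auto simp: block_def)

lemma block_mono: "I \<subseteq> J \<Longrightarrow> block A I \<subseteq> block A J"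
  by (auto simp: block_def)

lemma block_shift: "block A ((\<lambda>j. j + i) ` I) = (\<sigma> ^^ i) ` block A I"
proof -
  have "(\<sigma> ^^ (j + i)) ` A = (\<sigma> ^^ i) ` (\<sigma> ^^ j) ` A" for j
    unfolding image_comp funpow_add[symmetric] by (simp only: add.commute)
  then show ?thesis by (simp add: block_def image_UN)
qed

lemma block_Suc: "block A (Suc ` I) = \<sigma> ` block A I"
proof -
  have "Suc ` I = (\<lambda>j. j + 1) ` I" by (intro image_cong) auto
  then show ?thesis using block_shift[of A 1 I] by simp
qed

lemma block_singleton: "block A {i} = (\<sigma> ^^ i) ` A"
  by (simp add: block_def)

lemma block_block: "block (block A J) I = block A (\<Union>i\<in>I. (\<lambda>j. j + i) ` J)"
  unfolding block_def[of "block A J"] block_shift[symmetric] by (auto simp: block_def)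

lemma finite_block: "\<lbrakk> finite A; finite I \<rbrakk> \<Longrightarrow> finite (block A I)"
  by (auto simp: block_def)

lemma block_carrier: "A \<subseteq> carrier R \<Longrightarrow> block A I \<subseteq> carrier R"
  unfolding block_def by (intro UN_least funpow_image_carrier)

end

section \<open>Finite sets algebraic over each of their iterates\<close>

locale difference_algebraic = difference_extension +
  fixes A :: "'a set"
  assumes A_finite: "finite A" and A_carrier: "A \<subseteq> carrier R" and A_algebraic: "\<sigma> ` A \<subseteq> cl A"
begin

lemma block_subset_cl: "block A I \<subseteq> cl A"
proof -
  have "(\<sigma> ^^ i) ` A \<subseteq> cl A" for i
  proof (induction i)
    case (Suc i)
    have "(\<sigma> ^^ Suc i) ` A = \<sigma> ` (\<sigma> ^^ i) ` A" by (simp add: image_comp)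
    also have "\<dots> \<subseteq> \<sigma> ` cl A" using Suc by blast
    also have "\<dots> \<subseteq> cl A"
      using image_cl[OF A_carrier] cl_trans[OF A_algebraic A_carrier] by simp
    finally show ?case .
  qed (simp add: cl_incl[OF A_carrier])
  then show ?thesis by (auto simp: block_def)
qed

lemma subset_cl_funpow: "A \<subseteq> cl ((\<sigma> ^^ i) ` A)"
proof (induction i)
  case (Suc i)
  have carr: "(\<sigma> ^^ i) ` A \<subseteq> carrier R" for i using funpow_image_carrier[OF A_carrier] .
  have "A \<subseteq> cl (\<sigma> ` A)" using subset_cl_image[OF A_finite A_carrier A_algebraic] .
  then have "(\<sigma> ^^ i) ` A \<subseteq> cl ((\<sigma> ^^ i) ` \<sigma> ` A)"
    using funpow_image_cl[OF \<sigma>_image_carrier[OF A_carrier], of i] by blast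
  also have "(\<sigma> ^^ i) ` \<sigma> ` A = (\<sigma> ^^ Suc i) ` A"
    by (simp add: image_comp funpow_swap1 comp_def)
  finally show ?case using Suc cl_trans[OF _ carr] by blast
qed (simp add: cl_incl[OF A_carrier])

text \<open>This makes all degrees over a nonempty block finite: \<open>A\<close> is algebraic over
  any single iterate of itself, and all iterates are algebraic over \<open>A\<close>.\<close>

lemma block_subset_cl_block:
  assumes "I \<noteq> {}"
  shows "block A J \<subseteq> cl (block A I)"
proof -
  obtain i where "i \<in> I" using assms by blast
  then have "(\<sigma> ^^ i) ` A \<subseteq> block A I" by (auto simp: block_def)
  then have "A \<subseteq> cl (block A I)"
    using subset_cl_funpow[of i] cl_mono[OF _ block_carrier[OF A_carrier]] by blast
  then show ?thesis
    using block_subset_cl cl_trans[OF _ block_carrier[OF A_carrier]] by blast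
qed

lemma block_deg_tower:
  assumes "finite I" "I \<noteq> {}" "finite J" "finite L"
  shows "deg (block A I) (block A (J \<union> L)) = deg (block A I) (block A J) * deg (block A (I \<union> J)) (block A L)"
  unfolding block_Un
  by (intro deg_tower block_carrier A_carrier finite_block A_finite block_subset_cl_block assms)

lemma block_deg_antimono:
  assumes "I \<subseteq> I'" "I \<noteq> {}" "finite J"
  shows "deg (block A I') (block A J) \<le> deg (block A I) (block A J)"
  by (intro deg_antimono block_mono block_carrier A_carrier finite_block A_finite
    block_subset_cl_block assms)

lemma block_deg_shift:
  assumes "I \<noteq> {}" "finite J"
  shows "deg (block A (Suc ` I)) (block A (Suc ` J)) = deg (block A I) (block A J)"
  unfolding block_Suc
  by (intro deg_image block_carrier A_carrier finite_block A_finite block_subset_cl_block assms)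

lemma block_deg_pos:
  assumes "I \<noteq> {}" "finite J"
  shows "deg (block A I) (block A J) \<ge> 1"
  by (intro deg_pos block_carrier A_carrier finite_block A_finite block_subset_cl_block assms)

definition step_deg :: "nat \<Rightarrow> nat"
  where "step_deg k = deg (block A {0..k}) (block A {Suc k})"

text \<open>Dropping the iterate \<open>0\<close> from the base can only raise the degree, and what
  remains is a shift of the previous step.\<close>

lemma step_deg_Suc_le: "step_deg (Suc k) \<le> step_deg k"
proof -
  have "step_deg (Suc k) \<le> deg (block A (Suc ` {0..k})) (block A (Suc ` {Suc k}))"
    unfolding step_deg_def using block_deg_antimono[of "Suc ` {0..k}" "{0..Suc k}" "{Suc (Suc k)}"]
    by auto
  also have "\<dots> = step_deg k"
    unfolding step_deg_def by (intro block_deg_shift) auto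
  finally show ?thesis .
qed

lemma step_deg_pos: "step_deg k \<ge> 1"
  unfolding step_deg_def by (intro block_deg_pos) auto

lemma block_deg_eq_prod: "deg A (block A {1..l}) = (\<Prod>j<l. step_deg j)"
proof (induction l)
  case 0
  have "deg A {} = 1" using A_carrier by (intro deg_one) auto
  then show ?case by (simp add: block_def)
next
  case (Suc l)
  have "{1..Suc l} = {1..l} \<union> {Suc l}" "{0} \<union> {1..l} = {0..l}" "block A {0} = A"
    by (auto simp: block_def)
  then have "deg A (block A {1..Suc l}) = deg A (block A {1..l}) * step_deg l"
    using block_deg_tower[of "{0}" "{1..l}" "{Suc l}"] by (simp add: step_deg_def)
  then show ?case using Suc by simp
qed

end

lemma nat_antitone_eventually_const:
  fixes f :: "nat \<Rightarrow> nat"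
  assumes "\<And>k. f (Suc k) \<le> f k"
  shows "\<exists>N. (\<forall>k\<ge>N. f k = f N) \<and> (\<forall>k. f N \<le> f k)"
proof -
  obtain N where N: "\<And>k. f N \<le> f k" using ex_has_least_nat[of "\<lambda>_. True" _ f] by auto
  have "f k = f N" if "k \<ge> N" for k
    using lift_Suc_antimono_le[of f, OF assms that] N[of k] by simp
  then show ?thesis using N by blast
qed

section \<open>Stable step degrees and persistent coefficients\<close>

context difference_algebraic begin

text \<open>If the step degrees of \<open>A\<close> are constant from \<open>M\<close> on, then
  those of \<open>block A {0..M}\<close> are constant throughout, since its step \<open>k\<close> is
  the step \<open>k + M\<close> of \<open>A\<close>.\<close>

lemma stable_block:
  obtains M where "difference_algebraic R K \<sigma> (block A {0..M})"
    "index_degree (\<lambda>I J. deg (block (block A {0..M}) I) (block (block A {0..M}) J))"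
proof -
  obtain M where M: "\<And>k. k \<ge> M \<Longrightarrow> step_deg k = step_deg M"
    using nat_antitone_eventually_const[of step_deg, OF step_deg_Suc_le] by blast
  let ?A = "block A {0..M}"
  have alg: "difference_algebraic R K \<sigma> ?A"
  proof unfold_locales
    show "finite ?A" using finite_block A_finite by simp
    show "?A \<subseteq> carrier R" using block_carrier A_carrier by simp
    show "\<sigma> ` ?A \<subseteq> cl ?A"
      unfolding block_Suc[symmetric] by (intro block_subset_cl_block) auto
  qed
  then interpret B: difference_algebraic R K \<sigma> ?A .
  have B_step: "B.step_deg k = step_deg M" for k
  proof -
    have 1: "(\<Union>i\<in>{0..k}. (\<lambda>j. j + i) ` {0..M}) = {0..k + M}"
    proof -
      have "x \<in> (\<Union>i\<in>{0..k}. (\<lambda>j. j + i) ` {0..M})" if "x \<le> k + M" for x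
      proof -
        have "x = (x - min x k) + min x k" "x - min x k \<in> {0..M}" "min x k \<in> {0..k}"
          using that by auto
        then show ?thesis by blast
      qed
      then show ?thesis by auto
    qed
    have 2: "(\<Union>i\<in>{Suc k}. (\<lambda>j. j + i) ` {0..M}) = {Suc k..Suc (k + M)}"
    proof -
      have "(\<lambda>j. j + Suc k) ` {0..M} = {0 + Suc k..M + Suc k}"
        by (rule image_add_atLeastAtMost')
      also have "\<dots> = {Suc k..Suc (k + M)}" by (simp add: add.commute)
      finally show ?thesis by (simp only: UN_insert UN_empty Un_empty_right)
    qed
    \<comment> \<open>Over the iterates up to \<open>k + M\<close>, the next shifted block
      contributes only the iterate \<open>Suc (k + M)\<close>.\<close>
    have 3: "block A {0..k + M} \<union> block A {Suc k..Suc (k + M)} =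
      block A {0..k + M} \<union> block A {Suc (k + M)}"
      unfolding block_Un[symmetric] by (intro arg_cong[of _ _ "block A"]) auto
    have "B.step_deg k = step_deg (k + M)"
      unfolding B.step_deg_def step_deg_def block_block 1 2 deg_def 3 ..
    then show ?thesis using M[of "k + M"] by simp
  qed
  have "index_degree (\<lambda>I J. deg (block ?A I) (block ?A J))"
  proof
    show "deg (block ?A {0..k}) (block ?A {Suc k}) = deg (block ?A {0}) (block ?A {1})" for k
      using B_step[of k] B_step[of 0] by (simp add: B.step_deg_def)
    show "deg (block ?A I) (block ?A (J \<union> L)) =
      deg (block ?A I) (block ?A J) * deg (block ?A (I \<union> J)) (block ?A L)"
      if "finite I" "I \<noteq> {}" "finite J" "finite L" for I J L
      using that by (rule B.block_deg_tower)
    show "0 < deg (block ?A I) (block ?A J)" if "finite I" "I \<noteq> {}" "finite J" for I J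
      using B.block_deg_pos[of I J] that by simp
  qed (use B.block_deg_antimono B.block_deg_shift in auto)
  then show ?thesis using that alg by blast
qed

text \<open>The coefficients of the minimal polynomials of \<open>\<sigma>\<^sup>N(a)\<close> over \<open>K(a, \<sigma>\<^sup>2\<^sup>N(a))\<close>: for large
  \<open>N\<close> these polynomials stay minimal when the two ends are moved further apart.\<close>

lemma exists_persistent:
  assumes "index_degree (\<lambda>I J. deg (block A I) (block A J))"
  shows "\<exists>C N. finite C \<and> A \<subseteq> cl C \<and>
    (\<forall>i k. i + 2 * N \<le> k \<longrightarrow> (\<sigma> ^^ i) ` C \<subseteq> Fld (A \<union> (\<sigma> ^^ k) ` A))"
proof -
  interpret index_degree "\<lambda>I J. deg (block A I) (block A J)" by fact
  obtain N where N:
    "\<And>i k. i + 2 * N \<le> k \<Longrightarrow> deg (block A {0, i, i + 2 * N, k}) (block A {i + N}) =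
      deg (block A {i, i + 2 * N}) (block A {i + N})"
    "\<And>i k. i + 2 * N \<le> k \<Longrightarrow> deg (block A {0, i, i + 2 * N, k}) (block A {i + N}) =
      deg (block A {0, k}) (block A {i + N})"
    using deg_between_const by blast
  note carr = block_carrier[OF A_carrier]
  note fin = finite_block[OF A_finite]
  define C where "C = (\<Union>x\<in>block A {N}. set (Irr (Fld (block A {0, 2 * N})) x))"
  have "finite C" unfolding C_def using fin by auto
  have pers: "(\<sigma> ^^ i) ` C \<subseteq> Fld (A \<union> (\<sigma> ^^ k) ` A)" if "i + 2 * N \<le> k" for i k
  proof
    fix c assume "c \<in> (\<sigma> ^^ i) ` C"
    then obtain x where x: "x \<in> block A {N}"
      and c: "c \<in> set (map (\<sigma> ^^ i) (Irr (Fld (block A {0, 2 * N})) x))"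
      by (auto simp: C_def)
    let ?y = "(\<sigma> ^^ i) x" let ?U = "block A {0, i, i + 2 * N, k}"
    have x_cl: "x \<in> cl (block A {0, 2 * N})" using subsetD[OF block_subset_cl_block x] by simp
    have shift: "(\<sigma> ^^ i) ` block A {0, 2 * N} = block A {i, i + 2 * N}"
      "(\<sigma> ^^ i) ` block A {N} = block A {i + N}"
      using block_shift[of A i "{0, 2 * N}"] block_shift[of A i "{N}"] by (simp_all add: add.commute)
    have y: "?y \<in> block A {i + N}" using x shift by blast
    have y_cl: "?y \<in> cl (block A I)" if "I \<noteq> {}" for I
      using subsetD[OF block_subset_cl_block[OF that] y] .
    have sub: "block A {i, i + 2 * N} \<subseteq> ?U" "block A {0, k} \<subseteq> ?U" by (auto intro!: block_mono)
    \<comment> \<open>Applying \<open>\<sigma> ^^ i\<close> moves the ends to \<open>i\<close> and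
      \<open>i + 2 * N\<close>. The degree stays the same over the larger \<open>?U\<close>, and
      also from \<open>{0, k}\<close> to \<open>?U\<close>, so the minimal polynomials over the two
      pairs of ends agree.\<close>
    have "map (\<sigma> ^^ i) (Irr (Fld (block A {0, 2 * N})) x) = Irr (Fld (block A {i, i + 2 * N})) ?y"
      using funpow_Irr_image[OF carr x_cl, of i] shift by simp
    also have "\<dots> = Irr (Fld ?U) ?y"
      using N(1)[OF that] y
      by (intro Irr_eq_if_deg_eq[symmetric] deg_eq_imp_deg_singleton_eq[of _ _ "block A {i + N}"]
        sub carr fin y_cl block_subset_cl_block) auto
    also have "\<dots> = Irr (Fld (block A {0, k})) ?y"
      using N(2)[OF that] y
      by (intro Irr_eq_if_deg_eq deg_eq_imp_deg_singleton_eq[of _ _ "block A {i + N}"]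
        sub carr fin y_cl block_subset_cl_block) auto
    finally have c: "c \<in> set (Irr (Fld (block A {0, k})) ?y)" using c by simp
    have "?y \<in> carrier R" "(algebraic over (Fld (block A {0, k}))) ?y"
      using y_cl[of "{0, k}"] by (auto simp: cl_def)
    then have "set (Irr (Fld (block A {0, k})) ?y) \<subseteq> Fld (block A {0, k})"
      using IrrE(1)[OF Fld_subfield[OF carr]] polynomial_incl
      unfolding univ_poly_carrier[symmetric] by blast
    then show "c \<in> Fld (A \<union> (\<sigma> ^^ k) ` A)" using c by (auto simp: block_def)
  qed
  \<comment> \<open>\<open>C\<close> contains all coefficients of a nonzero equation of each such
    \<open>x\<close>.\<close>
  have "block A {N} \<subseteq> cl C"
  proof
    fix x assume x: "x \<in> block A {N}"
    let ?F = "Fld (block A {0, 2 * N})"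
    have x_cl: "x \<in> cl (block A {0, 2 * N})" using subsetD[OF block_subset_cl_block x] by simp
    then have x': "x \<in> carrier R" "(algebraic over ?F) x" by (auto simp: cl_def)
    note I = IrrE[OF Fld_subfield[OF carr] x'] Irr_not_Nil[OF carr x_cl]
    have "set (Irr ?F x) \<subseteq> Fld C" using x Fld_incl(1)[of C] by (auto simp: C_def)
    then have "Irr ?F x \<in> carrier ((Fld C)[X])"
      using I(1) unfolding univ_poly_carrier[symmetric] polynomial_def by auto
    then show "x \<in> cl C" using algebraicI I(4,5) x' by (auto simp: cl_def)
  qed
  moreover have C: "C \<subseteq> carrier R"
    using pers[of 0 "2 * N"] Fld_carrier[of "A \<union> (\<sigma> ^^ (2 * N)) ` A"] A_carrier
      funpow_image_carrier by auto
  ultimately have "A \<subseteq> cl C"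
    using subset_cl_funpow[of N] cl_trans[OF _ C] unfolding block_singleton by blast
  with \<open>finite C\<close> pers show ?thesis by blast
qed

end

section \<open>Growth of degrees\<close>

text \<open>The limit \<open>n\<close> is the minimum of \<open>f\<close>, attained from some index
  on; the finitely many earlier factors go into \<open>B\<close>.\<close>

lemma prod_antitone_bounds:
  fixes f :: "nat \<Rightarrow> nat"
  assumes "\<And>k. f (Suc k) \<le> f k" "\<And>k. f k \<ge> 1"
  shows "\<exists>n B. n \<ge> 1 \<and> (\<lambda>k. real (f k)) \<longlonglongrightarrow> real n \<and>
    (\<forall>l. n ^ l \<le> (\<Prod>j<l. f j) \<and> (\<Prod>j<l. f j) \<le> B * n ^ l)"
proof -
  obtain N where N: "\<And>k. k \<ge> N \<Longrightarrow> f k = f N" "\<And>k. f N \<le> f k"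
    using nat_antitone_eventually_const[of f, OF assms(1)] by blast
  have lower: "f N ^ l \<le> (\<Prod>j<l. f j)" for l
    using prod_mono[of "{..<l}" "\<lambda>_. f N" f] N(2) by simp
  have upper: "(\<Prod>j<l. f j) \<le> (\<Prod>j<N. f j) * f N ^ l" for l
  proof (cases "l \<le> N")
    case True
    have "(\<Prod>j<l. f j) dvd (\<Prod>j<N. f j)"
      using True by (intro prod_dvd_prod_subset) auto
    moreover have "(\<Prod>j<N. f j) > 0"
      using assms(2) by (intro prod_pos) (simp add: Suc_le_eq)
    ultimately have "(\<Prod>j<l. f j) \<le> (\<Prod>j<N. f j)" by (rule dvd_imp_le)
    also have "\<dots> \<le> (\<Prod>j<N. f j) * f N ^ l" using assms(2)[of N] by simp
    finally show ?thesis .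
  next
    case False
    then have "(\<Prod>j<l. f j) = (\<Prod>j<N. f j) * (\<Prod>j\<in>{N..<l}. f j)"
      using prod.atLeastLessThan_concat[of 0 N l f] by (simp add: lessThan_atLeast0)
    also have "(\<Prod>j\<in>{N..<l}. f j) = f N ^ (l - N)"
    proof -
      have "(\<Prod>j\<in>{N..<l}. f j) = (\<Prod>j\<in>{N..<l}. f N)"
        using N(1) by (intro prod.cong) (metis atLeastLessThan_iff)+
      then show ?thesis by simp
    qed
    also have "\<dots> \<le> f N ^ l" using assms(2)[of N] by (intro power_increasing) auto
    finally show ?thesis by simp
  qed
  have "(\<lambda>k. real (f k)) \<longlonglongrightarrow> real (f N)"
    by (rule tendsto_eventually, rule eventually_mono[OF eventually_ge_at_top])
      (rule arg_cong[OF N(1)])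
  then show ?thesis using lower upper assms(2)[of N] by blast
qed

text \<open>The \<open>k\<close>-th roots of the constant \<open>b\<close> tend to 1, so bounded
  factors do not affect the limit.\<close>

lemma root_tendsto:
  fixes D :: "nat \<Rightarrow> nat"
  assumes "n \<ge> 1" "b \<ge> 1" "\<And>k. k \<ge> s \<Longrightarrow> n ^ k \<le> b * D k" "\<And>k. D k \<le> b * n ^ k"
  shows "(\<lambda>k. real (D k) powr (1 / real k)) \<longlonglongrightarrow> real n"
proof (rule tendsto_sandwich)
  have root: "real (n ^ k) powr (1 / real k) = real n" if "k > 0" for k
    using that assms(1) by (simp add: powr_realpow[symmetric] powr_powr)
  have const: "(\<lambda>k. real b powr (1 / real k)) \<longlonglongrightarrow> 1"
    using tendsto_powr[OF tendsto_const lim_1_over_n, of "real b"] assms(2) by simp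
  show "(\<lambda>k. real n / real b powr (1 / real k)) \<longlonglongrightarrow> real n"
    using tendsto_divide[OF tendsto_const const, of "real n"] by simp
  show "(\<lambda>k. real b powr (1 / real k) * real n) \<longlonglongrightarrow> real n"
    using tendsto_mult[OF const tendsto_const, of "real n"] by simp
  show "\<forall>\<^sub>F k in sequentially. real n / real b powr (1 / real k) \<le> real (D k) powr (1 / real k)"
    using eventually_ge_at_top[of "max 1 s"]
  proof eventually_elim
    case (elim k)
    have "real n = real (n ^ k) powr (1 / real k)" using root elim by simp
    also have "\<dots> \<le> real (b * D k) powr (1 / real k)"
      using assms(3)[of k] elim by (intro powr_mono2) (auto simp del: of_nat_power of_nat_mult)
    also have "\<dots> = real b powr (1 / real k) * real (D k) powr (1 / real k)"
      by (simp add: powr_mult)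
    finally show ?case using assms(2) by (simp add: divide_le_eq mult.commute)
  qed
  show "\<forall>\<^sub>F k in sequentially. real (D k) powr (1 / real k) \<le> real b powr (1 / real k) * real n"
    using eventually_ge_at_top[of 1]
  proof eventually_elim
    case (elim k)
    have "real (D k) powr (1 / real k) \<le> real (b * n ^ k) powr (1 / real k)"
      using assms(4)[of k] by (intro powr_mono2) (auto simp del: of_nat_power of_nat_mult)
    also have "\<dots> = real b powr (1 / real k) * real (n ^ k) powr (1 / real k)"
      by (simp add: powr_mult)
    finally show ?case using root[of k] elim by simp
  qed
qed

section \<open>Comparison of growth for interalgebraic sets\<close>

context difference_extension begin

lemma difference_algebraic_interalgebraic:
  assumes "difference_algebraic R K \<sigma> A" "finite C" "C \<subseteq> cl A" "A \<subseteq> cl C"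
  shows "difference_algebraic R K \<sigma> C"
proof -
  interpret A: difference_algebraic R K \<sigma> A by fact
  have C: "C \<subseteq> carrier R" using assms(3) cl_carrier by blast
  have "\<sigma> ` C \<subseteq> cl (\<sigma> ` A)" using image_cl[OF A.A_carrier] assms(3) by blast
  also have "\<dots> \<subseteq> cl A" using cl_trans[OF A.A_algebraic A.A_carrier] .
  also have "\<dots> \<subseteq> cl C" using cl_trans[OF assms(4) C] .
  finally show ?thesis using C assms(2) by unfold_locales
qed

text \<open>Starting from \<open>C\<close>, adjoin \<open>A\<close>, then its iterate, then the
  iterate of \<open>C\<close>. Over smaller bases the last two steps are bounded by the degree for
  \<open>A\<close> and by \<open>deg A C\<close>, the latter transported by
  \<open>\<sigma> ^^ k\<close>.\<close>

lemma deg_funpow_le: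
  assumes "difference_algebraic R K \<sigma> A" "finite C" "C \<subseteq> cl A" "A \<subseteq> cl C"
  shows "deg C ((\<sigma> ^^ k) ` C) \<le> deg C A * deg A C * deg A ((\<sigma> ^^ k) ` A)"
proof -
  interpret A: difference_algebraic R K \<sigma> A by fact
  interpret C: difference_algebraic R K \<sigma> C
    using difference_algebraic_interalgebraic[OF assms] .
  let ?\<tau> = "\<sigma> ^^ k"
  note carr = A.A_carrier C.A_carrier funpow_image_carrier[OF A.A_carrier, of k]
  have iter: "?\<tau> ` A \<subseteq> cl A" "?\<tau> ` C \<subseteq> cl C"
    using A.block_subset_cl[of "{k}"] C.block_subset_cl[of "{k}"] by (simp_all add: block_singleton)
  have tA: "?\<tau> ` A \<subseteq> cl C" using iter(1) cl_trans[OF assms(4) carr(2)] by blast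
  have tC: "?\<tau> ` C \<subseteq> cl (?\<tau> ` A)" using funpow_image_cl[OF A.A_carrier, of k] assms(3) by blast
  have "deg C (?\<tau> ` C) \<le> deg C ((A \<union> ?\<tau> ` A) \<union> ?\<tau> ` C)"
    using carr assms iter tA A.A_finite by (intro deg_mono) auto
  also have "\<dots> = deg C A * deg (C \<union> A) (?\<tau> ` A) * deg (C \<union> (A \<union> ?\<tau> ` A)) (?\<tau> ` C)"
    using deg_tower[of C "A \<union> ?\<tau> ` A" "?\<tau> ` C"] deg_tower[of C A "?\<tau> ` A"]
      carr assms iter tA A.A_finite by simp
  also have "\<dots> \<le> deg C A * deg A (?\<tau> ` A) * deg (?\<tau> ` A) (?\<tau> ` C)"
    using carr assms iter tC A.A_finite by (intro mult_le_mono deg_antimono) auto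
  also have "deg (?\<tau> ` A) (?\<tau> ` C) = deg A C"
    using funpow_deg_image[OF A.A_carrier assms(2,3)] .
  finally show ?thesis by (simp add: mult_ac)
qed

definition dd_set_seq :: "'a set \<Rightarrow> nat \<Rightarrow> real"
  where "dd_set_seq A k = real (deg A ((\<sigma> ^^ k) ` A)) powr (1 / real k)"

definition ld_set_seq :: "'a set \<Rightarrow> nat \<Rightarrow> real"
  where "ld_set_seq A k = real (deg (block A {0..k}) (block A {Suc k}))"

text \<open>The block degree of \<open>C\<close> is the product of its step degrees, hence of order
  \<open>n ^ l\<close>. The last hypothesis bounds it by the degree of one iterate up to the factor
  \<open>b\<close> and the shift \<open>s\<close>, so this degree has the same order, and
  \<open>deg_funpow_le\<close> carries the order over to \<open>A\<close>.\<close>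

lemma growth_limits:
  assumes "difference_algebraic R K \<sigma> A" "finite C" "C \<subseteq> cl A" "A \<subseteq> cl C"
    and "\<And>l. deg C (block C {1..l}) \<le> b * deg C ((\<sigma> ^^ (l + s)) ` C)"
  shows "\<exists>L. ld_set_seq C \<longlonglongrightarrow> L \<and> dd_set_seq C \<longlonglongrightarrow> L \<and> dd_set_seq A \<longlonglongrightarrow> L"
proof -
  interpret A: difference_algebraic R K \<sigma> A by fact
  have C: "difference_algebraic R K \<sigma> C"
    using difference_algebraic_interalgebraic[OF assms(1-4)] .
  interpret C: difference_algebraic R K \<sigma> C by fact
  obtain n B where n: "n \<ge> 1" "(\<lambda>k. real (C.step_deg k)) \<longlonglongrightarrow> real n"
    and lower: "\<And>l. n ^ l \<le> (\<Prod>j<l. C.step_deg j)"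
    and upper: "\<And>l. (\<Prod>j<l. C.step_deg j) \<le> B * n ^ l"
    using prod_antitone_bounds[of C.step_deg] C.step_deg_Suc_le C.step_deg_pos by blast
  have dd: "dd_set_seq E \<longlonglongrightarrow> real n"
    if E: "difference_algebraic R K \<sigma> E" "C \<subseteq> cl E" "E \<subseteq> cl C" for E
  proof -
    interpret E: difference_algebraic R K \<sigma> E by fact
    \<comment> \<open>In \<open>?b\<close> the first summand serves the lower bound, with
      \<open>n ^ s\<close> for the shift \<open>k = l + s\<close>, the second serves the upper
      bound, and 1 ensures \<open>?b \<ge> 1\<close>.\<close>
    let ?c = "deg C E * deg E C" let ?b = "n ^ s * b * ?c + ?c * B + 1"
    have CE: "deg C ((\<sigma> ^^ k) ` C) \<le> ?c * deg E ((\<sigma> ^^ k) ` E)" for k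
      using deg_funpow_le[OF E(1) assms(2) E(2,3)] .
    have EC: "deg E ((\<sigma> ^^ k) ` E) \<le> ?c * deg C ((\<sigma> ^^ k) ` C)" for k
      using deg_funpow_le[OF C E.A_finite E(3,2)] by (simp add: mult.commute)
    show ?thesis
      unfolding dd_set_seq_def
    proof (rule root_tendsto[OF n(1), of ?b s])
      fix k :: nat assume "s \<le> k"
      then obtain l where l: "k = l + s" using le_Suc_ex by (metis add.commute)
      have "n ^ k = n ^ s * n ^ l" by (simp add: l power_add)
      also have "n ^ l \<le> b * deg C ((\<sigma> ^^ k) ` C)"
        using lower[of l] assms(5)[of l] C.block_deg_eq_prod[of l] l by simp
      also have "b * deg C ((\<sigma> ^^ k) ` C) \<le> b * (?c * deg E ((\<sigma> ^^ k) ` E))"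
        using CE by simp
      finally have "n ^ k \<le> n ^ s * b * ?c * deg E ((\<sigma> ^^ k) ` E)"
        by (simp add: mult_ac)
      then show "n ^ k \<le> ?b * deg E ((\<sigma> ^^ k) ` E)" by (simp add: add_mult_distrib)
    next
      fix k
      have "deg E ((\<sigma> ^^ k) ` E) \<le> ?c * (B * n ^ k)"
      \<comment> \<open>The block \<open>{1..k}\<close> contains the iterate \<open>k\<close> only
        for positive \<open>k\<close>.\<close>
      proof (cases "k = 0")
        case True
        have "deg E E = 1" by (intro deg_one E.A_carrier Fld_incl)
        moreover have "deg C E \<ge> 1" by (intro deg_pos C.A_carrier E.A_finite E(3))
        moreover have "deg E C \<ge> 1" by (intro deg_pos E.A_carrier C.A_finite E(2))
        moreover have "B \<ge> 1" using upper[of 0] by simp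
        ultimately show ?thesis using True by (simp add: Suc_le_eq)
      next
        case False
        have "deg C ((\<sigma> ^^ k) ` C) \<le> deg C (block C {1..k})"
          unfolding block_singleton[symmetric] using False
          by (intro deg_mono block_mono C.A_carrier finite_block C.A_finite C.block_subset_cl) auto
        also have "\<dots> \<le> B * n ^ k" using upper C.block_deg_eq_prod by simp
        finally show ?thesis using EC[of k] by (meson le_trans mult_le_mono2)
      qed
      also have "\<dots> \<le> ?b * n ^ k" by (simp add: add_mult_distrib mult.assoc)
      finally show "deg E ((\<sigma> ^^ k) ` E) \<le> ?b * n ^ k" .
    qed simp
  qed
  have "ld_set_seq C \<longlonglongrightarrow> real n"
    using n(2) by (simp add: ld_set_seq_def[abs_def] C.step_deg_def)
  then show ?thesis
    using dd[OF assms(1,3,4)] dd[OF C cl_incl[OF C.A_carrier] cl_incl[OF C.A_carrier]] by blast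
qed

text \<open>Applying \<open>\<sigma> ^^ i\<close> to the hypothesis for \<open>l - i\<close> gives
  the iterate \<open>Suc i\<close> from the iterates \<open>i\<close> and \<open>l\<close>. By
  induction all iterates up to \<open>l\<close> lie in the field of the two ends, so
  \<open>growth_limits\<close> applies with \<open>b = 1\<close> and \<open>s = 0\<close>.\<close>

lemma growth_if_between:
  assumes "difference_algebraic R K \<sigma> A" "finite C" "C \<subseteq> cl A" "A \<subseteq> cl C"
    and between: "\<And>l. l > 0 \<Longrightarrow> \<sigma> ` C \<subseteq> Fld (C \<union> (\<sigma> ^^ l) ` C)"
  shows "\<exists>L. ld_set_seq C \<longlonglongrightarrow> L \<and> dd_set_seq A \<longlonglongrightarrow> L"
proof -
  interpret C: difference_algebraic R K \<sigma> C
    using difference_algebraic_interalgebraic[OF assms(1-4)] .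
  have carr: "C \<union> (\<sigma> ^^ l) ` C \<subseteq> carrier R" for l
    using C.A_carrier funpow_image_carrier[OF C.A_carrier] by blast
  have "(\<sigma> ^^ i) ` C \<subseteq> Fld (C \<union> (\<sigma> ^^ l) ` C)" if "i \<le> l" for i l
    using that
  proof (induction i)
    case 0
    then show ?case using Fld_incl(1)[of "C \<union> (\<sigma> ^^ l) ` C"] by simp
  next
    case (Suc i)
    have "(\<sigma> ^^ Suc i) ` C = (\<sigma> ^^ i) ` \<sigma> ` C"
      by (simp add: image_comp funpow_swap1 comp_def)
    also have "\<dots> \<subseteq> (\<sigma> ^^ i) ` Fld (C \<union> (\<sigma> ^^ (l - i)) ` C)"
      using between[of "l - i"] Suc.prems by (intro image_mono) auto
    also have "\<dots> = Fld ((\<sigma> ^^ i) ` C \<union> (\<sigma> ^^ l) ` C)"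
      using funpow_image_Fld[OF carr] Suc.prems funpow_add[of i "l - i" \<sigma>]
      by (simp add: image_Un image_comp)
    also have "\<dots> \<subseteq> Fld (C \<union> (\<sigma> ^^ l) ` C)"
      using Suc Fld_incl(1)[of "C \<union> (\<sigma> ^^ l) ` C"] by (intro Fld_le carr) auto
    finally show ?case .
  qed
  then have block: "block C {1..l} \<subseteq> Fld (C \<union> (\<sigma> ^^ l) ` C)" for l
    unfolding block_def by (intro UN_least) auto
  have "deg C (block C {1..l}) \<le> 1 * deg C ((\<sigma> ^^ (l + 0)) ` C)" for l
  proof -
    have fin: "finite (block C {1..l})" "block C {1..l} \<subseteq> cl C" "(\<sigma> ^^ l) ` C \<subseteq> cl C"
      using finite_block[OF C.A_finite] C.block_subset_cl C.block_subset_cl[of "{l}"]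
      by (simp_all add: block_singleton)
    have "deg C (block C {1..l}) \<le> deg C ((\<sigma> ^^ l) ` C \<union> block C {1..l})"
      using fin C.A_finite C.A_carrier by (intro deg_mono) auto
    also have "\<dots> = deg C ((\<sigma> ^^ l) ` C)"
      using deg_tower[OF C.A_carrier _ fin(3,1,2)] C.A_finite deg_one[OF carr block] by simp
    finally show ?thesis by simp
  qed
  from growth_limits[OF assms(1-4) this] show ?thesis by blast
qed

text \<open>\<open>C\<close> consists of the persistent coefficients for a stable enlargement
  \<open>?A\<close> of \<open>A\<close>. Its iterates up to \<open>l\<close> lie in the field
  generated by \<open>?A\<close> and the iterate \<open>l + 2 * N\<close> of \<open>?A\<close>,
  which gives \<open>growth_limits\<close> with \<open>s = 2 * N\<close>.\<close>

lemma exists_dd_eq_ld: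
  assumes "difference_algebraic R K \<sigma> A"
  shows "\<exists>C L. finite C \<and> C \<subseteq> Fld (block A UNIV) \<and> A \<subseteq> cl C \<and>
    ld_set_seq C \<longlonglongrightarrow> L \<and> dd_set_seq C \<longlonglongrightarrow> L \<and> dd_set_seq A \<longlonglongrightarrow> L"
proof -
  interpret A: difference_algebraic R K \<sigma> A by fact
  obtain M where M: "difference_algebraic R K \<sigma> (block A {0..M})"
    "index_degree (\<lambda>I J. deg (block (block A {0..M}) I) (block (block A {0..M}) J))"
    by (rule A.stable_block)
  let ?A = "block A {0..M}"
  interpret B: difference_algebraic R K \<sigma> ?A by fact
  obtain C N where C: "finite C" "?A \<subseteq> cl C"
    and persistent: "\<forall>i k. i + 2 * N \<le> k \<longrightarrow> (\<sigma> ^^ i) ` C \<subseteq> Fld (?A \<union> (\<sigma> ^^ k) ` ?A)"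
    using B.exists_persistent[OF M(2)] by (elim exE conjE) (rule that)
  have carr: "?A \<union> (\<sigma> ^^ k) ` ?A \<subseteq> carrier R" for k
    using B.A_carrier funpow_image_carrier[OF B.A_carrier] by blast
  have A_sub: "A \<subseteq> ?A" by (force simp: block_def)
  have A_cl: "?A \<union> (\<sigma> ^^ k) ` ?A \<subseteq> cl A" for k
    unfolding block_shift[symmetric] by (intro Un_least A.block_subset_cl)
  have C_sub: "C \<subseteq> Fld (?A \<union> (\<sigma> ^^ (2 * N)) ` ?A)" using persistent[rule_format, of 0 "2 * N"] by simp
  then have C_cl: "C \<subseteq> cl A" using Fld_subset_cl_if[OF A_cl A.A_carrier] by blast
  have A_cl_C: "A \<subseteq> cl C" using A_sub C(2) by blast
  interpret C: difference_algebraic R K \<sigma> C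
    using difference_algebraic_interalgebraic[OF assms C(1) C_cl A_cl_C] .
  have C_clB: "C \<subseteq> cl ?A"
    using C_cl cl_mono[OF A_sub B.A_carrier] by blast
  \<comment> \<open>The first factor \<open>deg C ?A\<close> pays for adjoining \<open>?A\<close> to
    \<open>C\<close>; the other two come from \<open>deg_funpow_le\<close>, which replaces the
    iterate of \<open>?A\<close> by that of \<open>C\<close>.\<close>
  have bound: "deg C (block C {1..l}) \<le> (deg C ?A * (deg ?A C * deg C ?A)) * deg C ((\<sigma> ^^ (l + 2 * N)) ` C)" for l
  proof -
    let ?T = "(\<sigma> ^^ (l + 2 * N)) ` ?A"
    have "block C {1..l} \<subseteq> Fld (?A \<union> ?T)"
      unfolding block_def[of C] using persistent by (intro UN_least) auto
    also have "\<dots> \<subseteq> Fld (C \<union> (?A \<union> ?T))"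
      using carr C.A_carrier by (intro Fld_mono) auto
    finally have sub: "block C {1..l} \<subseteq> Fld (C \<union> (?A \<union> ?T))" .
    have T: "?T \<subseteq> cl ?A" using B.block_subset_cl[of "{l + 2 * N}"] by (simp add: block_singleton)
    have T': "?T \<subseteq> cl C" using T cl_trans[OF C(2) C.A_carrier] by blast
    have fin: "finite (block C {1..l})" "block C {1..l} \<subseteq> cl C"
      using finite_block[OF C.A_finite] C.block_subset_cl by simp_all
    have "deg C (block C {1..l}) \<le> deg C ((?A \<union> ?T) \<union> block C {1..l})"
      using fin B.A_finite C T' C.A_carrier by (intro deg_mono) auto
    also have "\<dots> = deg C (?A \<union> ?T) * deg (C \<union> (?A \<union> ?T)) (block C {1..l})"
      using fin B.A_finite C T' C.A_carrier by (intro deg_tower) auto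
    also have "deg (C \<union> (?A \<union> ?T)) (block C {1..l}) = 1"
      using carr C.A_carrier by (intro deg_one sub) auto
    also have "deg C (?A \<union> ?T) = deg C ?A * deg (C \<union> ?A) ?T"
      using B.A_finite C T' C.A_carrier by (intro deg_tower) auto
    also have "deg (C \<union> ?A) ?T \<le> deg ?A ?T"
      using B.A_finite C.A_carrier B.A_carrier T by (intro deg_antimono) auto
    also have "deg ?A ?T \<le> deg ?A C * deg C ?A * deg C ((\<sigma> ^^ (l + 2 * N)) ` C)"
      using deg_funpow_le[OF C.difference_algebraic_axioms B.A_finite C(2) C_clB] .
    finally show ?thesis by (simp add: mult_ac)
  qed
  have "Fld (?A \<union> (\<sigma> ^^ (2 * N)) ` ?A) \<subseteq> Fld (block A UNIV)"
    unfolding block_shift[symmetric] block_Un[symmetric]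
    by (intro Fld_mono block_mono block_carrier A.A_carrier) auto
  then have "C \<subseteq> Fld (block A UNIV)" using C_sub by blast
  then show ?thesis
    using growth_limits[OF assms C(1) C_cl A_cl_C bound] C(1) A_cl_C by blast
qed

end

section \<open>Passage from finite sets back to tuples\<close>

theorem theorem1p9:
  fixes U :: "('a, 'b) ring_scheme" and \<sigma> :: "'a \<Rightarrow> 'a" and K :: "'a set" and a :: "'a list"
  assumes "algebraically_closed U"
    and "\<sigma> \<in> ring_iso U U"
    and "subfield K U"
    and "\<sigma> ` K = K"
    and "set a \<subseteq> carrier U"
    and "set (map \<sigma> a) \<subseteq> acl U (adjoin U K a)"
  shows "(\<forall>c. set c \<subseteq> difference_adjoin U \<sigma> K a \<and>
              set a \<subseteq> acl U (adjoin U K c) \<and>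
              (\<forall>l>0. set (map \<sigma> c) \<subseteq> adjoin U K (c @ map (\<sigma> ^^ l) c)) \<longrightarrow>
              convergent (dd_seq U \<sigma> a K) \<and> convergent (ld_seq U \<sigma> c K) \<and>
              dd U \<sigma> a K = ld U \<sigma> c K) \<and>
         (\<exists>c. set c \<subseteq> difference_adjoin U \<sigma> K a \<and>
              set a \<subseteq> acl U (adjoin U K c) \<and>
              convergent (dd_seq U \<sigma> c K) \<and> convergent (ld_seq U \<sigma> c K) \<and>
              convergent (dd_seq U \<sigma> a K) \<and>
              dd U \<sigma> c K = ld U \<sigma> c K \<and> ld U \<sigma> c K = dd U \<sigma> a K)"
proof -
  interpret algebraically_closed U by fact
  interpret difference_extension U K \<sigma>
    using assms(2-4) by (intro difference_extension.intro extension.intro extension_axioms.intro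
      difference_extension_axioms.intro field_axioms)
  have adjoin: "adjoin U K b = Fld (set b)" for b by (simp add: adjoin_def Fld_def)
  have acl: "acl U (adjoin U K b) = cl (set b)" for b by (simp add: adjoin acl_def cl_def)
  have iterates: "adjoin_iterates U \<sigma> K b k = Fld (block (set b) {0..k})" for b k
    by (simp add: adjoin_iterates_def Fld_def block_def atMost_atLeast0)
  have difference_adjoin: "difference_adjoin U \<sigma> K a = Fld (block (set a) UNIV)"
    by (simp add: difference_adjoin_def Fld_def block_def)
  have mu: "mu U b (Fld S) = deg S (set b)" if "S \<subseteq> carrier U" "set b \<subseteq> carrier U" for S b
    using that by (simp add: mu_def adjoin_def deg_def generate_field_Fld)
  have ld_seq: "ld_seq U \<sigma> b K = ld_set_seq (set b)"
    and dd_seq: "dd_seq U \<sigma> b K = dd_set_seq (set b)" if "set b \<subseteq> carrier U" for b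
    unfolding ld_seq_def dd_seq_def ld_set_seq_def dd_set_seq_def iterates adjoin
    using that mu block_carrier[OF that] funpow_image_carrier[OF that]
    by (auto simp: block_singleton fun_eq_iff simp del: funpow.simps)
  interpret A: difference_algebraic U K \<sigma> "set a"
    using assms(5,6) by unfold_locales (simp_all add: acl)
  have diff_cl: "Fld (block (set a) UNIV) \<subseteq> cl (set a)"
    by (intro Fld_subset_cl_if A.block_subset_cl A.A_carrier)
  note A = A.difference_algebraic_axioms
  \<comment> \<open>\<open>lim\<close> is informative only for convergent sequences, so convergence
    is recorded together with the equality of limits.\<close>
  have lims: "convergent f \<and> convergent g \<and> lim f = lim g" if "f \<longlonglongrightarrow> L" "g \<longlonglongrightarrow> L"
    for f g :: "nat \<Rightarrow> real" and L
    using that limI by (auto simp: convergent_def)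
  show ?thesis
  proof (intro conjI allI impI)
    fix c
    assume c: "set c \<subseteq> difference_adjoin U \<sigma> K a \<and> set a \<subseteq> acl U (adjoin U K c) \<and>
      (\<forall>l>0. set (map \<sigma> c) \<subseteq> adjoin U K (c @ map (\<sigma> ^^ l) c))"
    then have C: "set c \<subseteq> cl (set a)" "set a \<subseteq> cl (set c)"
      unfolding difference_adjoin acl using diff_cl by blast+
    have between: "\<And>l. l > 0 \<Longrightarrow> \<sigma> ` set c \<subseteq> Fld (set c \<union> (\<sigma> ^^ l) ` set c)"
      using c by (auto simp: adjoin)
    have "set c \<subseteq> carrier U" using C(1) cl_carrier by blast
    then show "convergent (dd_seq U \<sigma> a K)" "convergent (ld_seq U \<sigma> c K)"
      "dd U \<sigma> a K = ld U \<sigma> c K"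
      using growth_if_between[OF A _ C between] lims
      by (auto simp: dd_def ld_def dd_seq ld_seq A.A_carrier)
  next
    obtain C L where C: "finite C" "C \<subseteq> Fld (block (set a) UNIV)" "set a \<subseteq> cl C"
      and L: "ld_set_seq C \<longlonglongrightarrow> L" "dd_set_seq C \<longlonglongrightarrow> L" "dd_set_seq (set a) \<longlonglongrightarrow> L"
      using exists_dd_eq_ld[OF A] by blast
    obtain c where c: "set c = C" using finite_list[OF C(1)] by blast
    have "set c \<subseteq> carrier U" using C(2) c diff_cl cl_carrier by blast
    then show "\<exists>c. set c \<subseteq> difference_adjoin U \<sigma> K a \<and> set a \<subseteq> acl U (adjoin U K c) \<and>
      convergent (dd_seq U \<sigma> c K) \<and> convergent (ld_seq U \<sigma> c K) \<and>
      convergent (dd_seq U \<sigma> a K) \<and>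
      dd U \<sigma> c K = ld U \<sigma> c K \<and> ld U \<sigma> c K = dd U \<sigma> a K"
      using C c lims[OF L(2,1)] lims[OF L(1,3)]
      by (intro exI[of _ c]) (simp add: difference_adjoin acl dd_def ld_def dd_seq ld_seq A.A_carrier)
  qed
qed

end
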